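(* Let $\mathrm{A}$ be a complex $3$-dimensional assosymmetric algebra. Then $\mathrm{A}$ is isomorphic to one of the semi-alternative algebras $\mathrm{A}_{01},\dots,\mathrm{A}_{13}$, $\mathrm{A}_{14}^{\alpha}$ ($\alpha\in\mathbb{C}$, $\alpha\neq0$), $\mathrm{A}_{15},\dots,\mathrm{A}_{24}$, $\mathrm{S}_{01}^{\alpha}$ ($\alpha\in\mathbb{C}$), $\mathrm{S}_{02},\dots,\mathrm{S}_{13}$ listed in the context.
   Context: Write $(x,y,z)=(xy)z-x(yz)$. An algebra is assosymmetric if $(x,y,z)=(y,x,z)=(x,z,y)$ for all $x,y,z$. An algebra is semi-alternative if $(x,y,z)=(y,z,x)$ for all $x,y,z$. The algebras below are given in a basis $e_1,e_2,e_3$. For $\mathrm{A}_{01},\dots,\mathrm{A}_{11}$ the multiplication is commutative, and products neither listed nor obtained from listed ones by commutativity are zero; for all the others, products not listed are zero. $\mathrm{A}_{01}$: $e_1e_1=e_1$, $e_2e_2=e_2$; $\mathrm{A}_{02}$: $e_1e_1=e_1$, $e_1e_2=e_2$; $\mathrm{A}_{03}$: $e_1e_1=e_1$; $\mathrm{A}_{04}$: $e_1e_1=e_2$; $\mathrm{A}_{05}$: $e_1e_2=e_3$; $\mathrm{A}_{06}$: $e_1e_1=e_2$, $e_1e_2=e_3$; $\mathrm{A}_{07}$: $e_1e_1=e_1$, $e_2e_2=e_2$, $e_3e_3=e_3$; $\mathrm{A}_{08}$: $e_1e_1=e_1$, $e_2e_2=e_2$, $e_2e_3=e_3$; $\mathrm{A}_{09}$: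 $e_1e_1=e_1$, $e_1e_2=e_2$, $e_1e_3=e_3$; $\mathrm{A}_{10}$: $e_1e_1=e_1$, $e_1e_2=e_2$, $e_1e_3=e_3$, $e_2e_2=e_3$; $\mathrm{A}_{11}$: $e_1e_1=e_1$, $e_2e_2=e_3$; $\mathrm{A}_{12}$: $e_1e_2=e_3$, $e_2e_1=-e_3$; $\mathrm{A}_{13}$: $e_1e_1=e_2$, $e_1e_3=e_2$, $e_3e_1=-e_2$; $\mathrm{A}_{14}^{\alpha}$ ($\alpha\in\mathbb{C}$, $\alpha\neq0$): $e_1e_2=(1+\alpha)e_3$, $e_2e_1=(1-\alpha)e_3$; $\mathrm{A}_{15}$: $e_1e_1=e_1$, $e_1e_2=e_2$, $e_1e_3=e_3$, $e_3e_1=e_3$; $\mathrm{A}_{16}$: $e_1e_1=e_1$, $e_1e_3=e_3$, $e_2e_1=e_2$, $e_3e_1=e_3$; $\mathrm{A}_{17}$: $e_1e_1=e_1$, $e_1e_2=e_2$, $e_1e_3=e_3$; $\mathrm{A}_{18}$: $e_1e_1=e_1$, $e_2e_1=e_2$, $e_3e_1=e_3$; $\mathrm{A}_{19}$: $e_1e_1=e_1$, $e_1e_3=e_3$, $e_2e_1=e_2$; $\mathrm{A}_{20}$: $e_1e_1=e_1$, $e_1e_3=e_3$, $e_2e_2=e_2$, $e_3e_2=e_3$; $\mathrm{A}_{21}$: $e_1e_1=e_1$, $e_2e_1=e_2$; $\mathrm{A}_{22}$: $e_1e_1=e_1$, $e_1e_2=e_2$; $\mathrm{A}_{23}$: $e_1e_1=e_1$,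 $e_1e_3=e_3$, $e_2e_2=e_2$; $\mathrm{A}_{24}$: $e_1e_1=e_1$, $e_2e_2=e_2$, $e_3e_1=e_3$; $\mathrm{S}_{01}^{\alpha}$: $e_1e_1=e_2$, $e_1e_2=(\alpha+1)e_3$, $e_2e_1=(\alpha-1)e_3$; $\mathrm{S}_{02}$: $e_1e_1=2e_1+e_2$, $e_1e_2=2e_2$, $e_3e_1=2e_3$; $\mathrm{S}_{03}$: $e_1e_1=2e_1+e_2+e_3$, $e_1e_2=2e_2$, $e_3e_1=2e_3$; $\mathrm{S}_{04}$: $e_1e_1=2e_1+e_3$, $e_1e_2=2e_2$, $e_3e_1=2e_3$; $\mathrm{S}_{05}$: $e_1e_1=2e_1+e_2$, $e_2e_1=2e_2$, $e_1e_3=2e_3$, $e_3e_1=2e_3$; $\mathrm{S}_{06}$: $e_1e_1=2e_1+e_2$, $e_2e_1=2e_2$, $e_3e_3=e_3$; $\mathrm{S}_{07}$: $e_1e_1=2e_1+e_2$, $e_2e_1=2e_2$; $\mathrm{S}_{08}$: $e_1e_1=2e_1+e_2$, $e_1e_2=2e_2$, $e_1e_3=2e_3$, $e_3e_1=2e_3$; $\mathrm{S}_{09}$: $e_1e_1=2e_1+e_2$, $e_1e_2=2e_2$, $e_3e_3=e_3$; $\mathrm{S}_{10}$: $e_1e_1=2e_1+e_2$, $e_1e_2=2e_2$; $\mathrm{S}_{11}$: $e_1e_1=e_2+e_3$, $e_1e_2=e_2$, $e_2e_1=-e_2$, $e_1e_3=e_1$, $e_3e_1=e_1$, $e_2e_3=e_2$,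 $e_3e_2=e_2$, $e_3e_3=e_3$; $\mathrm{S}_{12}$: $e_1e_1=2e_1+e_2$, $e_1e_2=2e_2$, $e_1e_3=2e_3$; $\mathrm{S}_{13}$: $e_1e_1=2e_1+e_2$, $e_2e_1=2e_2$, $e_3e_1=2e_3$.
   Formalization: The algebra is additionally assumed to have a nonzero product: the 3-dimensional algebra with zero multiplication is assosymmetric but isomorphic to none of the listed algebras, all of which have a nonzero product. *)

theory Defs
  imports "HOL-Analysis.Analysis"
begin

section \<open>Algebras over the complex numbers\<close>

text \<open>An algebra is a vector space over the complex numbers, given by its underlying abelian group
  and scalar multiplication \<open>smul\<close>, with a bilinear product that need not be associative,
  commutative or unital. The type class of complex vector spaces does not exist in the library, so
  the scalar multiplication is explicit.\<close>

locale complex_algebra = vector_space smul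
  for smul :: "complex \<Rightarrow> 'a::ab_group_add \<Rightarrow> 'a" +
  fixes mul :: "'a \<Rightarrow> 'a \<Rightarrow> 'a"
  assumes linear_left: "Vector_Spaces.linear smul smul (\<lambda>x. mul x y)"
    and linear_right: "Vector_Spaces.linear smul smul (\<lambda>y. mul x y)"

definition associator :: "('a \<Rightarrow> 'a \<Rightarrow> 'a) \<Rightarrow> 'a \<Rightarrow> 'a \<Rightarrow> 'a \<Rightarrow> 'a::ab_group_add" where
  "associator mul x y z = mul (mul x y) z - mul x (mul y z)"

definition assosymmetric :: "('a \<Rightarrow> 'a \<Rightarrow> 'a::ab_group_add) \<Rightarrow> bool" where
  "assosymmetric mul \<longleftrightarrow>
    (\<forall>x y z. associator mul x y z = associator mul y x z \<and>
             associator mul x y z = associator mul x z y)"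

definition semi_alternative :: "('a \<Rightarrow> 'a \<Rightarrow> 'a::ab_group_add) \<Rightarrow> bool" where
  "semi_alternative mul \<longleftrightarrow>
    (\<forall>x y z. associator mul x y z = associator mul y z x)"

definition algebra_isomorphic ::
  "(complex \<Rightarrow> 'a::ab_group_add \<Rightarrow> 'a) \<Rightarrow> ('a \<Rightarrow> 'a \<Rightarrow> 'a) \<Rightarrow>
   (complex \<Rightarrow> 'b::ab_group_add \<Rightarrow> 'b) \<Rightarrow> ('b \<Rightarrow> 'b \<Rightarrow> 'b) \<Rightarrow> bool" where
  "algebra_isomorphic smul mul smul' mul' \<longleftrightarrow>
    (\<exists>f. Vector_Spaces.linear smul smul' f \<and> bij f \<and>
         (\<forall>x y. f (mul x y) = mul' (f x) (f y)))"


section \<open>Multiplication tables\<close>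

text \<open>The index type \<open>3\<close> has the elements \<open>1\<close>, \<open>2\<close> and \<open>3\<close> (where \<open>3 = 0\<close>).\<close>

definition e :: "3 \<Rightarrow> complex ^ 3" where
  "e i = axis i 1"

text \<open>A multiplication table lists entries \<open>((i, j), v)\<close>, meaning that the product of the
  \<open>i\<close>-th and the \<open>j\<close>-th basis vector is \<open>v\<close>; products that are not listed are zero.\<close>

type_synonym mult_table = "((3 \<times> 3) \<times> (complex ^ 3)) list"

definition entry :: "mult_table \<Rightarrow> 3 \<Rightarrow> 3 \<Rightarrow> complex ^ 3" where
  "entry t i j = (case map_of t (i, j) of None \<Rightarrow> 0 | Some v \<Rightarrow> v)"

definition mult_of :: "mult_table \<Rightarrow> complex ^ 3 \<Rightarrow> complex ^ 3 \<Rightarrow> complex ^ 3" where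
  "mult_of t x y = (\<Sum>i\<in>UNIV. \<Sum>j\<in>UNIV. (x $ i * y $ j) *s entry t i j)"

definition comm_table :: "mult_table \<Rightarrow> mult_table" where
  "comm_table t = t @ map (\<lambda>((i, j), v). ((j, i), v)) t"

definition tables_A_comm :: "mult_table set" where
  "tables_A_comm = comm_table ` {
    \<comment> \<open>\<open>A\<^sub>0\<^sub>1\<close>\<close> [((1,1), e 1), ((2,2), e 2)],
    \<comment> \<open>\<open>A\<^sub>0\<^sub>2\<close>\<close> [((1,1), e 1), ((1,2), e 2)],
    \<comment> \<open>\<open>A\<^sub>0\<^sub>3\<close>\<close> [((1,1), e 1)],
    \<comment> \<open>\<open>A\<^sub>0\<^sub>4\<close>\<close> [((1,1), e 2)],
    \<comment> \<open>\<open>A\<^sub>0\<^sub>5\<close>\<close> [((1,2), e 3)],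
    \<comment> \<open>\<open>A\<^sub>0\<^sub>6\<close>\<close> [((1,1), e 2), ((1,2), e 3)],
    \<comment> \<open>\<open>A\<^sub>0\<^sub>7\<close>\<close> [((1,1), e 1), ((2,2), e 2), ((3,3), e 3)],
    \<comment> \<open>\<open>A\<^sub>0\<^sub>8\<close>\<close> [((1,1), e 1), ((2,2), e 2), ((2,3), e 3)],
    \<comment> \<open>\<open>A\<^sub>0\<^sub>9\<close>\<close> [((1,1), e 1), ((1,2), e 2), ((1,3), e 3)],
    \<comment> \<open>\<open>A\<^sub>1\<^sub>0\<close>\<close> [((1,1), e 1), ((1,2), e 2), ((1,3), e 3), ((2,2), e 3)],
    \<comment> \<open>\<open>A\<^sub>1\<^sub>1\<close>\<close> [((1,1), e 1), ((2,2), e 3)]}"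

definition table_A14 :: "complex \<Rightarrow> mult_table" where
  "table_A14 \<alpha> = [((1,2), (1 + \<alpha>) *s e 3), ((2,1), (1 - \<alpha>) *s e 3)]"

definition tables_A_noncomm :: "mult_table set" where
  "tables_A_noncomm = {
    \<comment> \<open>\<open>A\<^sub>1\<^sub>2\<close>\<close> [((1,2), e 3), ((2,1), - e 3)],
    \<comment> \<open>\<open>A\<^sub>1\<^sub>3\<close>\<close> [((1,1), e 2), ((1,3), e 2), ((3,1), - e 2)],
    \<comment> \<open>\<open>A\<^sub>1\<^sub>5\<close>\<close> [((1,1), e 1), ((1,2), e 2), ((1,3), e 3), ((3,1), e 3)],
    \<comment> \<open>\<open>A\<^sub>1\<^sub>6\<close>\<close> [((1,1), e 1), ((1,3), e 3), ((2,1), e 2), ((3,1), e 3)],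
    \<comment> \<open>\<open>A\<^sub>1\<^sub>7\<close>\<close> [((1,1), e 1), ((1,2), e 2), ((1,3), e 3)],
    \<comment> \<open>\<open>A\<^sub>1\<^sub>8\<close>\<close> [((1,1), e 1), ((2,1), e 2), ((3,1), e 3)],
    \<comment> \<open>\<open>A\<^sub>1\<^sub>9\<close>\<close> [((1,1), e 1), ((1,3), e 3), ((2,1), e 2)],
    \<comment> \<open>\<open>A\<^sub>2\<^sub>0\<close>\<close> [((1,1), e 1), ((1,3), e 3), ((2,2), e 2), ((3,2), e 3)],
    \<comment> \<open>\<open>A\<^sub>2\<^sub>1\<close>\<close> [((1,1), e 1), ((2,1), e 2)],
    \<comment> \<open>\<open>A\<^sub>2\<^sub>2\<close>\<close> [((1,1), e 1), ((1,2), e 2)],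
    \<comment> \<open>\<open>A\<^sub>2\<^sub>3\<close>\<close> [((1,1), e 1), ((1,3), e 3), ((2,2), e 2)],
    \<comment> \<open>\<open>A\<^sub>2\<^sub>4\<close>\<close> [((1,1), e 1), ((2,2), e 2), ((3,1), e 3)]}"

definition table_S01 :: "complex \<Rightarrow> mult_table" where
  "table_S01 \<alpha> = [((1,1), e 2), ((1,2), (\<alpha> + 1) *s e 3), ((2,1), (\<alpha> - 1) *s e 3)]"

definition tables_S :: "mult_table set" where
  "tables_S = {
    \<comment> \<open>\<open>S\<^sub>0\<^sub>2\<close>\<close> [((1,1), 2 *s e 1 + e 2), ((1,2), 2 *s e 2), ((3,1), 2 *s e 3)],
    \<comment> \<open>\<open>S\<^sub>0\<^sub>3\<close>\<close> [((1,1), 2 *s e 1 + e 2 + e 3), ((1,2), 2 *s e 2), ((3,1), 2 *s e 3)],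
    \<comment> \<open>\<open>S\<^sub>0\<^sub>4\<close>\<close> [((1,1), 2 *s e 1 + e 3), ((1,2), 2 *s e 2), ((3,1), 2 *s e 3)],
    \<comment> \<open>\<open>S\<^sub>0\<^sub>5\<close>\<close> [((1,1), 2 *s e 1 + e 2), ((2,1), 2 *s e 2), ((1,3), 2 *s e 3), ((3,1), 2 *s e 3)],
    \<comment> \<open>\<open>S\<^sub>0\<^sub>6\<close>\<close> [((1,1), 2 *s e 1 + e 2), ((2,1), 2 *s e 2), ((3,3), e 3)],
    \<comment> \<open>\<open>S\<^sub>0\<^sub>7\<close>\<close> [((1,1), 2 *s e 1 + e 2), ((2,1), 2 *s e 2)],
    \<comment> \<open>\<open>S\<^sub>0\<^sub>8\<close>\<close> [((1,1), 2 *s e 1 + e 2), ((1,2), 2 *s e 2), ((1,3), 2 *s e 3), ((3,1), 2 *s e 3)],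
    \<comment> \<open>\<open>S\<^sub>0\<^sub>9\<close>\<close> [((1,1), 2 *s e 1 + e 2), ((1,2), 2 *s e 2), ((3,3), e 3)],
    \<comment> \<open>\<open>S\<^sub>1\<^sub>0\<close>\<close> [((1,1), 2 *s e 1 + e 2), ((1,2), 2 *s e 2)],
    \<comment> \<open>\<open>S\<^sub>1\<^sub>1\<close>\<close> [((1,1), e 2 + e 3), ((1,2), e 2), ((2,1), - e 2), ((1,3), e 1), ((3,1), e 1),
            ((2,3), e 2), ((3,2), e 2), ((3,3), e 3)],
    \<comment> \<open>\<open>S\<^sub>1\<^sub>2\<close>\<close> [((1,1), 2 *s e 1 + e 2), ((1,2), 2 *s e 2), ((1,3), 2 *s e 3)],
    \<comment> \<open>\<open>S\<^sub>1\<^sub>3\<close>\<close> [((1,1), 2 *s e 1 + e 2), ((2,1), 2 *s e 2), ((3,1), 2 *s e 3)]}"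

definition listed_tables :: "mult_table set" where
  "listed_tables = tables_A_comm \<union> tables_A_noncomm \<union> {table_A14 \<alpha> | \<alpha>. \<alpha> \<noteq> 0} \<union>
    range table_S01 \<union> tables_S"

end

theory Submission
  imports Defs "HOL-Computational_Algebra.Fundamental_Theorem_Algebra"
begin

text \<open>
  In characteristic zero the symmetry of the associator \<open>(x,y,z)\<close> turns the Teichmueller identity
  into \<open>(wx,y,z) = x(w,y,z) + (x,y,z)w\<close>, and commutators then lie in the nucleus. So
  \<open>(e,e,e) = [ee,e]\<close> is nuclear, and by polarization every associator is.

  If the algebra is not associative, some \<open>v = (e,e,e)\<close> is nonzero. In dimension three the nucleus
  must be a plane \<open>\<langle>v,n\<rangle>\<close> complementary to \<open>e\<close>, so the associator is the cube of a linear form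
  times \<open>v\<close>. If the nucleus is not an ideal, it contains a unit of the whole algebra, which gives
  \<open>S\<^sub>1\<^sub>1\<close>. Otherwise either the nucleus contains an idempotent that can be split off, or it has zero
  product and one diagonalizes (or, if \<open>ee\<close> is nuclear, finds nilpotent) the commuting left and right
  multiplications by \<open>e\<close> on it.

  An associative algebra is decomposed by Peirce's method: two orthogonal idempotents and one further
  Peirce vector, or one local idempotent and two nilpotent Peirce vectors, or a nil algebra, which is
  either generated by one element or given by a bilinear form on a plane.
\<close>

section \<open>Bases and multiplication tables\<close>

text \<open>Neither radicals nor Wedderburn theory are used: in dimension three an idempotent can be
  extracted from a linear relation between \<open>z\<close>, \<open>z^2\<close>, \<open>z^3\<close>,
  \<open>z^4\<close>, and eigenvalues come from the fundamental theorem of algebra applied to such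
  relations. The real obstacle in the nonassociative case is to show that the nucleus is larger than
  the line of \<open>v\<close>. Once this is known, a single linear form with kernel the nucleus
  carries all nonassociativity, and its values on products of basis vectors steer the case
  distinction. The factor 2 in the tables comes from scaling \<open>e\<close> so that its left and
  right multiplications have eigenvalues 0 and 2 on the nucleus. No table has zero product, so a
  nonzero product has to be assumed. It decides a case only for nil associative algebras whose
  squares all vanish.\<close>

lemma (in vector_space) span_pair_iff: "v \<in> span {x, y} \<longleftrightarrow> (\<exists>a b. v = scale a x + scale b y)"
proof
  assume "v \<in> span {x, y}"
  then obtain a b where "v - scale a x = scale b y"
    unfolding span_breakdown_eq span_singleton by blast
  then have "v = scale a x + scale b y" by (simp add: algebra_simps)
  then show "\<exists>a b. v = scale a x + scale b y" by blast
next
  assume "\<exists>a b. v = scale a x + scale b y"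
  then show "v \<in> span {x, y}"
    by (auto intro: span_add span_scale span_base)
qed

locale algebra3 = complex_algebra smul mul
  for smul :: "complex \<Rightarrow> 'a::ab_group_add \<Rightarrow> 'a" (infixr "\<odot>" 80)
    and mul :: "'a \<Rightarrow> 'a \<Rightarrow> 'a" (infixl "\<star>" 75) +
  assumes dim_3: "dim (UNIV :: 'a set) = 3"
begin

lemma mul_simps [simp]:
  "(x + y) \<star> z = x \<star> z + y \<star> z" "z \<star> (x + y) = z \<star> x + z \<star> y"
  "(x - y) \<star> z = x \<star> z - y \<star> z" "z \<star> (x - y) = z \<star> x - z \<star> y"
  "(- x) \<star> z = - (x \<star> z)" "z \<star> (- x) = - (z \<star> x)"
  "0 \<star> z = 0" "z \<star> 0 = 0"
  "(c \<odot> x) \<star> z = c \<odot> (x \<star> z)" "z \<star> (c \<odot> x) = c \<odot> (z \<star> x)"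
proof -
  interpret l: Vector_Spaces.linear smul smul "\<lambda>x. x \<star> z" for z by (rule linear_left)
  interpret r: Vector_Spaces.linear smul smul "\<lambda>x. z \<star> x" for z by (rule linear_right)
  show "(x + y) \<star> z = x \<star> z + y \<star> z" "z \<star> (x + y) = z \<star> x + z \<star> y"
  "(x - y) \<star> z = x \<star> z - y \<star> z" "z \<star> (x - y) = z \<star> x - z \<star> y"
  "(- x) \<star> z = - (x \<star> z)" "z \<star> (- x) = - (z \<star> x)"
  "0 \<star> z = 0" "z \<star> 0 = 0"
  "(c \<odot> x) \<star> z = c \<odot> (x \<star> z)" "z \<star> (c \<odot> x) = c \<odot> (z \<star> x)"
    using l.add[of x y z] l.diff[of x y z] l.neg[of x z] l.zero[of z] l.scale[of c x z]
      r.add[of z x y] r.diff[of z x y] r.neg[of z x] r.zero[of z] r.scale[of z c x] by simp_all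
qed

lemmas scale_distribs = scale_left_distrib scale_right_distrib scale_left_diff_distrib
  scale_right_diff_distrib

lemma outside_span2: "\<exists>z. \<forall>a b. z \<noteq> a \<odot> x + b \<odot> y"
proof (rule ccontr)
  assume "\<nexists>z. \<forall>a b. z \<noteq> a \<odot> x + b \<odot> y"
  then have "UNIV \<subseteq> span {x, y}"
    unfolding subset_iff span_pair_iff by blast
  then have "dim (UNIV :: 'a set) \<le> card {x, y}"
    by (intro dim_le_card) auto
  also have "\<dots> \<le> 2"
    by (simp add: card_insert_if)
  finally show False using dim_3 by simp
qed

text \<open>Independence of the family, not of the set: a repeated vector counts as dependent, which
  \<open>independent {x, y, z}\<close> would not notice.\<close>

definition indep3 :: "'a \<Rightarrow> 'a \<Rightarrow> 'a \<Rightarrow> bool" where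
  "indep3 x y z \<longleftrightarrow> (\<forall>a b c. a \<odot> x + b \<odot> y + c \<odot> z = 0 \<longrightarrow> a = 0 \<and> b = 0 \<and> c = 0)"

lemma indep3D: "indep3 x y z \<Longrightarrow> a \<odot> x + b \<odot> y + c \<odot> z = 0 \<Longrightarrow> a = 0 \<and> b = 0 \<and> c = 0"
  unfolding indep3_def by blast

lemma indep3I:
  assumes "x \<noteq> 0" "\<And>a. y \<noteq> a \<odot> x" "\<And>a b. z \<noteq> a \<odot> x + b \<odot> y"
  shows "indep3 x y z"
  unfolding indep3_def
proof (intro allI impI)
  fix a b c assume eq: "a \<odot> x + b \<odot> y + c \<odot> z = 0"
  have "c = 0"
  proof (rule ccontr)
    assume "c \<noteq> 0"
    have "c \<odot> z = - (a \<odot> x) - b \<odot> y" using eq by (simp add: algebra_simps eq_neg_iff_add_eq_0)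
    then have "(1/c) \<odot> c \<odot> z = (1/c) \<odot> (- (a \<odot> x) - b \<odot> y)" by simp
    then have "z = (- a / c) \<odot> x + (- b / c) \<odot> y"
      using \<open>c \<noteq> 0\<close> by (simp add: scale_distribs)
    with assms(3) show False by blast
  qed
  moreover have "b = 0"
  proof (rule ccontr)
    assume "b \<noteq> 0"
    have "b \<odot> y = - (a \<odot> x)" using eq \<open>c = 0\<close> by (simp add: algebra_simps eq_neg_iff_add_eq_0)
    then have "(1/b) \<odot> b \<odot> y = (1/b) \<odot> (- (a \<odot> x))" by simp
    then have "y = (- a / b) \<odot> x"
      using \<open>b \<noteq> 0\<close> by (simp add: scale_distribs)
    with assms(2) show False by blast
  qed
  ultimately show "a = 0 \<and> b = 0 \<and> c = 0"
    using eq assms(1) by simp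
qed

lemma indep3_distinct:
  assumes "indep3 x y z"
  shows "x \<noteq> y" "x \<noteq> z" "y \<noteq> z"
  using indep3D[OF assms, of 1 "-1" 0] indep3D[OF assms, of 1 0 "-1"] indep3D[OF assms, of 0 1 "-1"]
  by auto

lemma indep3_set:
  assumes "indep3 x y z"
  shows "independent {x, y, z}"
proof -
  have "z \<noteq> 0" using indep3D[OF assms, of 0 0 1] by auto
  moreover have "y \<notin> span {z}"
  proof
    assume "y \<in> span {z}"
    then obtain k where "y = k \<odot> z" unfolding span_singleton by blast
    then show False using indep3D[OF assms, of 0 1 "-k"] by simp
  qed
  moreover have "x \<notin> span {y, z}"
  proof
    assume "x \<in> span {y, z}"
    then obtain k where "x - k \<odot> y \<in> span {z}" unfolding span_breakdown_eq by blast
    then obtain l where "x - k \<odot> y = l \<odot> z" unfolding span_singleton by blast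
    then show False using indep3D[OF assms, of 1 "-k" "-l"] by simp
  qed
  ultimately show ?thesis
    by (simp add: independent_insert)
qed

lemma indep3_span:
  assumes "indep3 x y z"
  obtains a b c where "w = a \<odot> x + b \<odot> y + c \<odot> z"
proof -
  obtain B :: "'a set" where B: "independent B" "UNIV \<subseteq> span B" "card B = 3"
    using basis_exists[of UNIV] dim_3 by metis
  have "finite B" using B(3) by (simp add: card_ge_0_finite)
  have "w \<in> span {x, y, z}"
  proof (rule ccontr)
    assume w: "w \<notin> span {x, y, z}"
    then have indep: "independent {w, x, y, z}"
      using indep3_set[OF assms] by (rule independent_insertI)
    have "{w, x, y, z} \<subseteq> span B"
      using B(2) by (rule subset_trans[OF subset_UNIV])
    with independent_span_bound[OF \<open>finite B\<close> indep] have "card {w, x, y, z} \<le> card B"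
      by simp
    moreover have "w \<notin> {x, y, z}" using w span_base[of w "{x, y, z}"] by metis
    ultimately show False using indep3_distinct[OF assms] B(3) by simp
  qed
  then obtain a b c where "w - a \<odot> x - b \<odot> y = c \<odot> z"
    unfolding span_breakdown_eq span_singleton by blast
  then show thesis by (intro that[of a b c]) (simp add: algebra_simps)
qed

lemma indep3_unique:
  assumes "indep3 x y z" and eq: "a \<odot> x + b \<odot> y + c \<odot> z = a' \<odot> x + b' \<odot> y + c' \<odot> z"
  shows "a = a' \<and> b = b' \<and> c = c'"
proof -
  have "(a - a') \<odot> x + (b - b') \<odot> y + (c - c') \<odot> z =
      (a \<odot> x + b \<odot> y + c \<odot> z) - (a' \<odot> x + b' \<odot> y + c' \<odot> z)"
    by (simp add: scale_distribs)
  with eq have "(a - a') \<odot> x + (b - b') \<odot> y + (c - c') \<odot> z = 0"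
    by simp
  from indep3D[OF assms(1) this] show ?thesis by simp
qed

end

section \<open>Coordinates with respect to a basis\<close>

locale basis3 = algebra3 smul mul
  for smul :: "complex \<Rightarrow> 'a::ab_group_add \<Rightarrow> 'a" (infixr "\<odot>" 80)
    and mul :: "'a \<Rightarrow> 'a \<Rightarrow> 'a" (infixl "\<star>" 75) +
  fixes b1 b2 b3
  assumes indep: "indep3 b1 b2 b3"
begin

definition coords :: "'a \<Rightarrow> complex \<times> complex \<times> complex" where
  "coords w = (THE (a, b, c). w = a \<odot> b1 + b \<odot> b2 + c \<odot> b3)"

definition c1 where "c1 w = fst (coords w)"
definition c2 where "c2 w = fst (snd (coords w))"
definition c3 where "c3 w = snd (snd (coords w))"

lemma coords_comb: "coords (a \<odot> b1 + b \<odot> b2 + c \<odot> b3) = (a, b, c)"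
  unfolding coords_def
proof (rule the_equality)
  fix t assume t: "case t of (a', b', c') \<Rightarrow> a \<odot> b1 + b \<odot> b2 + c \<odot> b3 = a' \<odot> b1 + b' \<odot> b2 + c' \<odot> b3"
  obtain a' b' c' where abc: "t = (a', b', c')" by (cases t)
  with t have "a \<odot> b1 + b \<odot> b2 + c \<odot> b3 = a' \<odot> b1 + b' \<odot> b2 + c' \<odot> b3" by simp
  from indep3_unique[OF indep this] show "t = (a, b, c)" by (simp add: abc)
qed simp

lemma c_comb: "c1 (a \<odot> b1 + b \<odot> b2 + c \<odot> b3) = a" "c2 (a \<odot> b1 + b \<odot> b2 + c \<odot> b3) = b"
  "c3 (a \<odot> b1 + b \<odot> b2 + c \<odot> b3) = c"
  by (simp_all add: c1_def c2_def c3_def coords_comb)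

lemma expand: "w = c1 w \<odot> b1 + c2 w \<odot> b2 + c3 w \<odot> b3"
proof -
  obtain a b c where "w = a \<odot> b1 + b \<odot> b2 + c \<odot> b3" by (rule indep3_span[OF indep])
  then show ?thesis by (simp only: c_comb)
qed

lemma c_add [simp]: "c1 (x + y) = c1 x + c1 y" "c2 (x + y) = c2 x + c2 y" "c3 (x + y) = c3 x + c3 y"
proof -
  have "x + y = (c1 x + c1 y) \<odot> b1 + (c2 x + c2 y) \<odot> b2 + (c3 x + c3 y) \<odot> b3"
    by (subst expand[of x], subst expand[of y]) (simp add: scale_distribs)
  then show "c1 (x + y) = c1 x + c1 y" "c2 (x + y) = c2 x + c2 y" "c3 (x + y) = c3 x + c3 y"
    using c_comb by metis+
qed

lemma c_scale [simp]: "c1 (a \<odot> x) = a * c1 x" "c2 (a \<odot> x) = a * c2 x" "c3 (a \<odot> x) = a * c3 x"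
proof -
  have "a \<odot> x = (a * c1 x) \<odot> b1 + (a * c2 x) \<odot> b2 + (a * c3 x) \<odot> b3"
    by (subst expand[of x]) (simp add: scale_distribs)
  then show "c1 (a \<odot> x) = a * c1 x" "c2 (a \<odot> x) = a * c2 x" "c3 (a \<odot> x) = a * c3 x"
    using c_comb by metis+
qed

lemma c_zero [simp]: "c1 0 = 0" "c2 0 = 0" "c3 0 = 0"
  using c_scale[of 0 0] by simp_all

lemma c_uminus [simp]: "c1 (- x) = - c1 x" "c2 (- x) = - c2 x" "c3 (- x) = - c3 x"
  using c_scale[of "-1" x] by simp_all

lemma c_diff [simp]: "c1 (x - y) = c1 x - c1 y" "c2 (x - y) = c2 x - c2 y" "c3 (x - y) = c3 x - c3 y"
  using c_add[of x "-y"] by simp_all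

lemma c_basis [simp]: "c1 b1 = 1" "c1 b2 = 0" "c1 b3 = 0" "c2 b1 = 0" "c2 b2 = 1" "c2 b3 = 0"
  "c3 b1 = 0" "c3 b2 = 0" "c3 b3 = 1"
  using c_comb[of 1 0 0] c_comb[of 0 1 0] c_comb[of 0 0 1] by simp_all

text \<open>Turns an identity between vectors into three identities between complex numbers, so that
  \<open>field_simps\<close> can finish computations that divide by scalars.\<close>

lemma vec_eq: "x = y \<longleftrightarrow> c1 x = c1 y \<and> c2 x = c2 y \<and> c3 x = c3 y"
  using expand by metis

lemma indep3_coordsI:
  assumes "\<And>a b c. a * c1 x + b * c1 y + c * c1 z = 0 \<Longrightarrow> a * c2 x + b * c2 y + c * c2 z = 0 \<Longrightarrow>
    a * c3 x + b * c3 y + c * c3 z = 0 \<Longrightarrow> a = 0 \<and> b = 0 \<and> c = 0"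
  shows "indep3 x y z"
  unfolding indep3_def vec_eq by (intro allI impI assms) simp_all

end

section \<open>Recognizing a listed algebra from the products of a basis\<close>

context algebra3
begin

text \<open>Semi-alternativity is left out here: it depends on the isomorphism class alone and is
  transferred once, at the end.\<close>

definition listed :: bool where
  "listed \<longleftrightarrow> (\<exists>t\<in>listed_tables. algebra_isomorphic smul mul vector_scalar_mult (mult_of t))"

text \<open>The inverse of the coordinate map; with it, table entries are compared with products
  inside the algebra itself.\<close>

definition comb :: "'a \<Rightarrow> 'a \<Rightarrow> 'a \<Rightarrow> complex ^ 3 \<Rightarrow> 'a" where
  "comb x y z v = v $ 1 \<odot> x + v $ 2 \<odot> y + v $ 3 \<odot> z"

lemma comb_simps [simp]: "comb x y z 0 = 0" "comb x y z (e 1) = x" "comb x y z (e 2) = y" "comb x y z (e 3) = z"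
  "comb x y z (v + w) = comb x y z v + comb x y z w" "comb x y z (c *s v) = c \<odot> comb x y z v"
  "comb x y z (- v) = - comb x y z v" "comb x y z (v - w) = comb x y z v - comb x y z w"
  by (simp_all add: comb_def e_def axis_def scale_distribs)

lemma algebra_isomorphicI:
  assumes indep: "indep3 x y z"
    and tab: "x \<star> x = comb x y z (entry t 1 1)" "x \<star> y = comb x y z (entry t 1 2)"
      "x \<star> z = comb x y z (entry t 1 3)" "y \<star> x = comb x y z (entry t 2 1)"
      "y \<star> y = comb x y z (entry t 2 2)" "y \<star> z = comb x y z (entry t 2 3)"
      "z \<star> x = comb x y z (entry t 3 1)" "z \<star> y = comb x y z (entry t 3 2)"
      "z \<star> z = comb x y z (entry t 3 3)"
  shows "algebra_isomorphic smul mul vector_scalar_mult (mult_of t)"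
proof -
  interpret B: basis3 smul mul x y z
    by unfold_locales (rule indep)
  define f :: "'a \<Rightarrow> complex ^ 3" where "f w = (\<chi> i. if i = 1 then B.c1 w else if i = 2 then B.c2 w else B.c3 w)" for w
  have f_nth: "f w $ 1 = B.c1 w" "f w $ 2 = B.c2 w" "f w $ 3 = B.c3 w" for w
    by (simp_all add: f_def)
  have f_comb: "f (comb x y z v) = v" for v
    by (simp add: vec_eq_iff forall_3 f_nth comb_def)
  have comb_f: "comb x y z (f w) = w" for w
    using B.expand[of w] by (simp add: comb_def f_nth)
  interpret c3: vector_space "vector_scalar_mult :: complex \<Rightarrow> complex ^ 3 \<Rightarrow> complex ^ 3"
    by unfold_locales (vector algebra_simps)+
  have "Vector_Spaces.linear smul vector_scalar_mult f"
    by unfold_locales (simp_all add: vec_eq_iff forall_3 f_nth)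
  moreover have "bij f"
    using f_comb comb_f by (intro o_bij[of "comb x y z"]) auto
  moreover have "f (u \<star> w) = mult_of t (f u) (f w)" for u w
  proof -
    have "u \<star> w = comb x y z (f u) \<star> comb x y z (f w)"
      by (simp add: comb_f)
    also have "\<dots> = comb x y z (mult_of t (f u) (f w))"
      \<comment> \<open>Only the two factors are expanded into coordinates. The entries are read
        backwards through \<open>tab\<close>, so that both sides become the same sum of nine basis
        products.\<close>
      by (simp add: mult_of_def sum_3 comb_def[of x y z "f u"] comb_def[of x y z "f w"] tab[symmetric]
        scale_right_distrib mult.commute add_ac)
    finally show ?thesis by (simp add: f_comb)
  qed
  ultimately show ?thesis
    unfolding algebra_isomorphic_def by blast
qed

lemma listedI:
  assumes "indep3 x y z" "t \<in> listed_tables"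
    and "x \<star> x = comb x y z (entry t 1 1)" "x \<star> y = comb x y z (entry t 1 2)"
      "x \<star> z = comb x y z (entry t 1 3)" "y \<star> x = comb x y z (entry t 2 1)"
      "y \<star> y = comb x y z (entry t 2 2)" "y \<star> z = comb x y z (entry t 2 3)"
      "z \<star> x = comb x y z (entry t 3 1)" "z \<star> y = comb x y z (entry t 3 2)"
      "z \<star> z = comb x y z (entry t 3 3)"
  shows listed
  unfolding listed_def using algebra_isomorphicI[OF assms(1,3-)] assms(2) by blast

lemmas table_simps = listed_tables_def entry_def comm_table_def

text \<open>Here and in the companion lemmas the hypotheses run through the nine products row by
  row. In a commutative table a diagonal entry occurs twice with the same value, and
  \<open>map_of\<close> returns the first match.\<close>

lemma A01:
  assumes "indep3 x y z"
    "x \<star> x = x" "x \<star> y = 0" "x \<star> z = 0"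
    "y \<star> x = 0" "y \<star> y = y" "y \<star> z = 0"
    "z \<star> x = 0" "z \<star> y = 0" "z \<star> z = 0"
  shows listed
  by (rule listedI[OF assms(1), of "comm_table [((1,1), e 1), ((2,2), e 2)]"])
    (simp_all add: tables_A_comm_def table_simps assms)

lemma A02:
  assumes "indep3 x y z"
    "x \<star> x = x" "x \<star> y = y" "x \<star> z = 0"
    "y \<star> x = y" "y \<star> y = 0" "y \<star> z = 0"
    "z \<star> x = 0" "z \<star> y = 0" "z \<star> z = 0"
  shows listed
  by (rule listedI[OF assms(1), of "comm_table [((1,1), e 1), ((1,2), e 2)]"])
    (simp_all add: tables_A_comm_def table_simps assms)

lemma A03:
  assumes "indep3 x y z"
    "x \<star> x = x" "x \<star> y = 0" "x \<star> z = 0"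
    "y \<star> x = 0" "y \<star> y = 0" "y \<star> z = 0"
    "z \<star> x = 0" "z \<star> y = 0" "z \<star> z = 0"
  shows listed
  by (rule listedI[OF assms(1), of "comm_table [((1,1), e 1)]"])
    (simp_all add: tables_A_comm_def table_simps assms)

lemma A04:
  assumes "indep3 x y z"
    "x \<star> x = y" "x \<star> y = 0" "x \<star> z = 0"
    "y \<star> x = 0" "y \<star> y = 0" "y \<star> z = 0"
    "z \<star> x = 0" "z \<star> y = 0" "z \<star> z = 0"
  shows listed
  by (rule listedI[OF assms(1), of "comm_table [((1,1), e 2)]"])
    (simp_all add: tables_A_comm_def table_simps assms)

lemma A05:
  assumes "indep3 x y z"
    "x \<star> x = 0" "x \<star> y = z" "x \<star> z = 0"
    "y \<star> x = z" "y \<star> y = 0" "y \<star> z = 0"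
    "z \<star> x = 0" "z \<star> y = 0" "z \<star> z = 0"
  shows listed
  by (rule listedI[OF assms(1), of "comm_table [((1,2), e 3)]"])
    (simp_all add: tables_A_comm_def table_simps assms)

lemma A06:
  assumes "indep3 x y z"
    "x \<star> x = y" "x \<star> y = z" "x \<star> z = 0"
    "y \<star> x = z" "y \<star> y = 0" "y \<star> z = 0"
    "z \<star> x = 0" "z \<star> y = 0" "z \<star> z = 0"
  shows listed
  by (rule listedI[OF assms(1), of "comm_table [((1,1), e 2), ((1,2), e 3)]"])
    (simp_all add: tables_A_comm_def table_simps assms)

lemma A07:
  assumes "indep3 x y z"
    "x \<star> x = x" "x \<star> y = 0" "x \<star> z = 0"
    "y \<star> x = 0" "y \<star> y = y" "y \<star> z = 0"
    "z \<star> x = 0" "z \<star> y = 0" "z \<star> z = z"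
  shows listed
  by (rule listedI[OF assms(1), of "comm_table [((1,1), e 1), ((2,2), e 2), ((3,3), e 3)]"])
    (simp_all add: tables_A_comm_def table_simps assms)

lemma A08:
  assumes "indep3 x y z"
    "x \<star> x = x" "x \<star> y = 0" "x \<star> z = 0"
    "y \<star> x = 0" "y \<star> y = y" "y \<star> z = z"
    "z \<star> x = 0" "z \<star> y = z" "z \<star> z = 0"
  shows listed
  by (rule listedI[OF assms(1), of "comm_table [((1,1), e 1), ((2,2), e 2), ((2,3), e 3)]"])
    (simp_all add: tables_A_comm_def table_simps assms)

lemma A09:
  assumes "indep3 x y z"
    "x \<star> x = x" "x \<star> y = y" "x \<star> z = z"
    "y \<star> x = y" "y \<star> y = 0" "y \<star> z = 0"
    "z \<star> x = z" "z \<star> y = 0" "z \<star> z = 0"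
  shows listed
  by (rule listedI[OF assms(1), of "comm_table [((1,1), e 1), ((1,2), e 2), ((1,3), e 3)]"])
    (simp_all add: tables_A_comm_def table_simps assms)

lemma A10:
  assumes "indep3 x y z"
    "x \<star> x = x" "x \<star> y = y" "x \<star> z = z"
    "y \<star> x = y" "y \<star> y = z" "y \<star> z = 0"
    "z \<star> x = z" "z \<star> y = 0" "z \<star> z = 0"
  shows listed
  by (rule listedI[OF assms(1), of
      "comm_table [((1,1), e 1), ((1,2), e 2), ((1,3), e 3), ((2,2), e 3)]"])
    (simp_all add: tables_A_comm_def table_simps assms)

lemma A11:
  assumes "indep3 x y z"
    "x \<star> x = x" "x \<star> y = 0" "x \<star> z = 0"
    "y \<star> x = 0" "y \<star> y = z" "y \<star> z = 0"
    "z \<star> x = 0" "z \<star> y = 0" "z \<star> z = 0"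
  shows listed
  by (rule listedI[OF assms(1), of "comm_table [((1,1), e 1), ((2,2), e 3)]"])
    (simp_all add: tables_A_comm_def table_simps assms)

lemma A12:
  assumes "indep3 x y z"
    "x \<star> x = 0" "x \<star> y = z" "x \<star> z = 0"
    "y \<star> x = - z" "y \<star> y = 0" "y \<star> z = 0"
    "z \<star> x = 0" "z \<star> y = 0" "z \<star> z = 0"
  shows listed
  by (rule listedI[OF assms(1), of "[((1,2), e 3), ((2,1), - e 3)]"])
    (simp_all add: tables_A_noncomm_def table_simps assms)

lemma A13:
  assumes "indep3 x y z"
    "x \<star> x = y" "x \<star> y = 0" "x \<star> z = y"
    "y \<star> x = 0" "y \<star> y = 0" "y \<star> z = 0"
    "z \<star> x = - y" "z \<star> y = 0" "z \<star> z = 0"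
  shows listed
  by (rule listedI[OF assms(1), of "[((1,1), e 2), ((1,3), e 2), ((3,1), - e 2)]"])
    (simp_all add: tables_A_noncomm_def table_simps assms)

lemma A15:
  assumes "indep3 x y z"
    "x \<star> x = x" "x \<star> y = y" "x \<star> z = z"
    "y \<star> x = 0" "y \<star> y = 0" "y \<star> z = 0"
    "z \<star> x = z" "z \<star> y = 0" "z \<star> z = 0"
  shows listed
  by (rule listedI[OF assms(1), of "[((1,1), e 1), ((1,2), e 2), ((1,3), e 3), ((3,1), e 3)]"])
    (simp_all add: tables_A_noncomm_def table_simps assms)

lemma A16:
  assumes "indep3 x y z"
    "x \<star> x = x" "x \<star> y = 0" "x \<star> z = z"
    "y \<star> x = y" "y \<star> y = 0" "y \<star> z = 0"
    "z \<star> x = z" "z \<star> y = 0" "z \<star> z = 0"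
  shows listed
  by (rule listedI[OF assms(1), of "[((1,1), e 1), ((1,3), e 3), ((2,1), e 2), ((3,1), e 3)]"])
    (simp_all add: tables_A_noncomm_def table_simps assms)

lemma A17:
  assumes "indep3 x y z"
    "x \<star> x = x" "x \<star> y = y" "x \<star> z = z"
    "y \<star> x = 0" "y \<star> y = 0" "y \<star> z = 0"
    "z \<star> x = 0" "z \<star> y = 0" "z \<star> z = 0"
  shows listed
  by (rule listedI[OF assms(1), of "[((1,1), e 1), ((1,2), e 2), ((1,3), e 3)]"])
    (simp_all add: tables_A_noncomm_def table_simps assms)

lemma A18:
  assumes "indep3 x y z"
    "x \<star> x = x" "x \<star> y = 0" "x \<star> z = 0"
    "y \<star> x = y" "y \<star> y = 0" "y \<star> z = 0"
    "z \<star> x = z" "z \<star> y = 0" "z \<star> z = 0"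
  shows listed
  by (rule listedI[OF assms(1), of "[((1,1), e 1), ((2,1), e 2), ((3,1), e 3)]"])
    (simp_all add: tables_A_noncomm_def table_simps assms)

lemma A19:
  assumes "indep3 x y z"
    "x \<star> x = x" "x \<star> y = 0" "x \<star> z = z"
    "y \<star> x = y" "y \<star> y = 0" "y \<star> z = 0"
    "z \<star> x = 0" "z \<star> y = 0" "z \<star> z = 0"
  shows listed
  by (rule listedI[OF assms(1), of "[((1,1), e 1), ((1,3), e 3), ((2,1), e 2)]"])
    (simp_all add: tables_A_noncomm_def table_simps assms)

lemma A20:
  assumes "indep3 x y z"
    "x \<star> x = x" "x \<star> y = 0" "x \<star> z = z"
    "y \<star> x = 0" "y \<star> y = y" "y \<star> z = 0"
    "z \<star> x = 0" "z \<star> y = z" "z \<star> z = 0"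
  shows listed
  by (rule listedI[OF assms(1), of "[((1,1), e 1), ((1,3), e 3), ((2,2), e 2), ((3,2), e 3)]"])
    (simp_all add: tables_A_noncomm_def table_simps assms)

lemma A21:
  assumes "indep3 x y z"
    "x \<star> x = x" "x \<star> y = 0" "x \<star> z = 0"
    "y \<star> x = y" "y \<star> y = 0" "y \<star> z = 0"
    "z \<star> x = 0" "z \<star> y = 0" "z \<star> z = 0"
  shows listed
  by (rule listedI[OF assms(1), of "[((1,1), e 1), ((2,1), e 2)]"])
    (simp_all add: tables_A_noncomm_def table_simps assms)

lemma A22:
  assumes "indep3 x y z"
    "x \<star> x = x" "x \<star> y = y" "x \<star> z = 0"
    "y \<star> x = 0" "y \<star> y = 0" "y \<star> z = 0"
    "z \<star> x = 0" "z \<star> y = 0" "z \<star> z = 0"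
  shows listed
  by (rule listedI[OF assms(1), of "[((1,1), e 1), ((1,2), e 2)]"])
    (simp_all add: tables_A_noncomm_def table_simps assms)

lemma A23:
  assumes "indep3 x y z"
    "x \<star> x = x" "x \<star> y = 0" "x \<star> z = z"
    "y \<star> x = 0" "y \<star> y = y" "y \<star> z = 0"
    "z \<star> x = 0" "z \<star> y = 0" "z \<star> z = 0"
  shows listed
  by (rule listedI[OF assms(1), of "[((1,1), e 1), ((1,3), e 3), ((2,2), e 2)]"])
    (simp_all add: tables_A_noncomm_def table_simps assms)

lemma A24:
  assumes "indep3 x y z"
    "x \<star> x = x" "x \<star> y = 0" "x \<star> z = 0"
    "y \<star> x = 0" "y \<star> y = y" "y \<star> z = 0"
    "z \<star> x = z" "z \<star> y = 0" "z \<star> z = 0"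
  shows listed
  by (rule listedI[OF assms(1), of "[((1,1), e 1), ((2,2), e 2), ((3,1), e 3)]"])
    (simp_all add: tables_A_noncomm_def table_simps assms)

lemma S02:
  assumes "indep3 x y z"
    "x \<star> x = 2 \<odot> x + y" "x \<star> y = 2 \<odot> y" "x \<star> z = 0"
    "y \<star> x = 0" "y \<star> y = 0" "y \<star> z = 0"
    "z \<star> x = 2 \<odot> z" "z \<star> y = 0" "z \<star> z = 0"
  shows listed
  by (rule listedI[OF assms(1), of
      "[((1,1), 2 *s e 1 + e 2), ((1,2), 2 *s e 2), ((3,1), 2 *s e 3)]"])
    (simp_all add: tables_S_def table_simps assms)

lemma S03:
  assumes "indep3 x y z"
    "x \<star> x = 2 \<odot> x + y + z" "x \<star> y = 2 \<odot> y" "x \<star> z = 0"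
    "y \<star> x = 0" "y \<star> y = 0" "y \<star> z = 0"
    "z \<star> x = 2 \<odot> z" "z \<star> y = 0" "z \<star> z = 0"
  shows listed
  by (rule listedI[OF assms(1), of
      "[((1,1), 2 *s e 1 + e 2 + e 3), ((1,2), 2 *s e 2), ((3,1), 2 *s e 3)]"])
    (simp_all add: tables_S_def table_simps assms)

lemma S04:
  assumes "indep3 x y z"
    "x \<star> x = 2 \<odot> x + z" "x \<star> y = 2 \<odot> y" "x \<star> z = 0"
    "y \<star> x = 0" "y \<star> y = 0" "y \<star> z = 0"
    "z \<star> x = 2 \<odot> z" "z \<star> y = 0" "z \<star> z = 0"
  shows listed
  by (rule listedI[OF assms(1), of
      "[((1,1), 2 *s e 1 + e 3), ((1,2), 2 *s e 2), ((3,1), 2 *s e 3)]"])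
    (simp_all add: tables_S_def table_simps assms)

lemma S05:
  assumes "indep3 x y z"
    "x \<star> x = 2 \<odot> x + y" "x \<star> y = 0" "x \<star> z = 2 \<odot> z"
    "y \<star> x = 2 \<odot> y" "y \<star> y = 0" "y \<star> z = 0"
    "z \<star> x = 2 \<odot> z" "z \<star> y = 0" "z \<star> z = 0"
  shows listed
  by (rule listedI[OF assms(1), of
      "[((1,1), 2 *s e 1 + e 2), ((2,1), 2 *s e 2), ((1,3), 2 *s e 3), ((3,1), 2 *s e 3)]"])
    (simp_all add: tables_S_def table_simps assms)

lemma S06:
  assumes "indep3 x y z"
    "x \<star> x = 2 \<odot> x + y" "x \<star> y = 0" "x \<star> z = 0"
    "y \<star> x = 2 \<odot> y" "y \<star> y = 0" "y \<star> z = 0"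
    "z \<star> x = 0" "z \<star> y = 0" "z \<star> z = z"
  shows listed
  by (rule listedI[OF assms(1), of "[((1,1), 2 *s e 1 + e 2), ((2,1), 2 *s e 2), ((3,3), e 3)]"])
    (simp_all add: tables_S_def table_simps assms)

lemma S07:
  assumes "indep3 x y z"
    "x \<star> x = 2 \<odot> x + y" "x \<star> y = 0" "x \<star> z = 0"
    "y \<star> x = 2 \<odot> y" "y \<star> y = 0" "y \<star> z = 0"
    "z \<star> x = 0" "z \<star> y = 0" "z \<star> z = 0"
  shows listed
  by (rule listedI[OF assms(1), of "[((1,1), 2 *s e 1 + e 2), ((2,1), 2 *s e 2)]"])
    (simp_all add: tables_S_def table_simps assms)

lemma S08:
  assumes "indep3 x y z"
    "x \<star> x = 2 \<odot> x + y" "x \<star> y = 2 \<odot> y" "x \<star> z = 2 \<odot> z"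
    "y \<star> x = 0" "y \<star> y = 0" "y \<star> z = 0"
    "z \<star> x = 2 \<odot> z" "z \<star> y = 0" "z \<star> z = 0"
  shows listed
  by (rule listedI[OF assms(1), of
      "[((1,1), 2 *s e 1 + e 2), ((1,2), 2 *s e 2), ((1,3), 2 *s e 3), ((3,1), 2 *s e 3)]"])
    (simp_all add: tables_S_def table_simps assms)

lemma S09:
  assumes "indep3 x y z"
    "x \<star> x = 2 \<odot> x + y" "x \<star> y = 2 \<odot> y" "x \<star> z = 0"
    "y \<star> x = 0" "y \<star> y = 0" "y \<star> z = 0"
    "z \<star> x = 0" "z \<star> y = 0" "z \<star> z = z"
  shows listed
  by (rule listedI[OF assms(1), of "[((1,1), 2 *s e 1 + e 2), ((1,2), 2 *s e 2), ((3,3), e 3)]"])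
    (simp_all add: tables_S_def table_simps assms)

lemma S10:
  assumes "indep3 x y z"
    "x \<star> x = 2 \<odot> x + y" "x \<star> y = 2 \<odot> y" "x \<star> z = 0"
    "y \<star> x = 0" "y \<star> y = 0" "y \<star> z = 0"
    "z \<star> x = 0" "z \<star> y = 0" "z \<star> z = 0"
  shows listed
  by (rule listedI[OF assms(1), of "[((1,1), 2 *s e 1 + e 2), ((1,2), 2 *s e 2)]"])
    (simp_all add: tables_S_def table_simps assms)

lemma S11:
  assumes "indep3 x y z"
    "x \<star> x = y + z" "x \<star> y = y" "x \<star> z = x"
    "y \<star> x = - y" "y \<star> y = 0" "y \<star> z = y"
    "z \<star> x = x" "z \<star> y = y" "z \<star> z = z"
  shows listed
  by (rule listedI[OF assms(1), of
      "[((1,1), e 2 + e 3), ((1,2), e 2), ((2,1), - e 2), ((1,3), e 1), ((3,1), e 1),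
       ((2,3), e 2), ((3,2), e 2), ((3,3), e 3)]"])
    (simp_all add: tables_S_def table_simps assms)

lemma S12:
  assumes "indep3 x y z"
    "x \<star> x = 2 \<odot> x + y" "x \<star> y = 2 \<odot> y" "x \<star> z = 2 \<odot> z"
    "y \<star> x = 0" "y \<star> y = 0" "y \<star> z = 0"
    "z \<star> x = 0" "z \<star> y = 0" "z \<star> z = 0"
  shows listed
  by (rule listedI[OF assms(1), of
      "[((1,1), 2 *s e 1 + e 2), ((1,2), 2 *s e 2), ((1,3), 2 *s e 3)]"])
    (simp_all add: tables_S_def table_simps assms)

lemma S13:
  assumes "indep3 x y z"
    "x \<star> x = 2 \<odot> x + y" "x \<star> y = 0" "x \<star> z = 0"
    "y \<star> x = 2 \<odot> y" "y \<star> y = 0" "y \<star> z = 0"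
    "z \<star> x = 2 \<odot> z" "z \<star> y = 0" "z \<star> z = 0"
  shows listed
  by (rule listedI[OF assms(1), of
      "[((1,1), 2 *s e 1 + e 2), ((2,1), 2 *s e 2), ((3,1), 2 *s e 3)]"])
    (simp_all add: tables_S_def table_simps assms)

lemma A14:
  assumes "indep3 x y z" "\<alpha> \<noteq> 0"
    "x \<star> x = 0" "x \<star> y = (1 + \<alpha>) \<odot> z" "x \<star> z = 0"
    "y \<star> x = (1 - \<alpha>) \<odot> z" "y \<star> y = 0" "y \<star> z = 0"
    "z \<star> x = 0" "z \<star> y = 0" "z \<star> z = 0"
  shows listed
proof -
  have "table_A14 \<alpha> \<in> listed_tables"
    using \<open>\<alpha> \<noteq> 0\<close> by (auto simp: listed_tables_def)
  then show ?thesis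
    by (rule listedI[OF assms(1)]) (simp_all add: table_A14_def table_simps assms scale_distribs)
qed

lemma S01:
  assumes "indep3 x y z"
    "x \<star> x = y" "x \<star> y = (\<alpha> + 1) \<odot> z" "x \<star> z = 0"
    "y \<star> x = (\<alpha> - 1) \<odot> z" "y \<star> y = 0" "y \<star> z = 0"
    "z \<star> x = 0" "z \<star> y = 0" "z \<star> z = 0"
  shows listed
proof -
  have "table_S01 \<alpha> \<in> listed_tables"
    by (simp add: listed_tables_def)
  then show ?thesis
    by (rule listedI[OF assms(1)]) (simp_all add: table_S01_def table_simps assms scale_distribs)
qed

end

section \<open>Associative algebras with idempotents\<close>

locale assoc3 = algebra3 smul mul
  for smul :: "complex \<Rightarrow> 'a::ab_group_add \<Rightarrow> 'a" (infixr "\<odot>" 80)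
    and mul :: "'a \<Rightarrow> 'a \<Rightarrow> 'a" (infixl "\<star>" 75) +
  assumes assoc: "(x \<star> y) \<star> z = x \<star> (y \<star> z)"
begin

text \<open>In dimension three a nonzero polynomial without constant term and of degree at most 4
  kills \<open>z\<close>. Dividing by its lowest coefficient expresses \<open>z^3\<close> through
  higher powers, unless \<open>z^4 = 0\<close>. The two factorizations hand over to \<open>g\<close>
  every relation \<open>f z = z\<close>, \<open>f z = 0\<close>, \<open>z f = z\<close> or
  \<open>z f = 0\<close> with another idempotent \<open>f\<close>.\<close>

lemma nilpotent_or_idempotent:
  obtains "z \<star> (z \<star> (z \<star> z)) = 0"
  | g h h' where "g \<noteq> 0" "g \<star> g = g" "g = z \<star> h" "g = h' \<star> z"
proof -
  have "\<exists>a b c d. (a, b, c, d) \<noteq> (0, 0, 0, 0) \<and>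
      a \<odot> z + b \<odot> (z \<star> z) + c \<odot> (z \<star> (z \<star> z)) + d \<odot> (z \<star> (z \<star> (z \<star> z))) = 0"
  proof (cases "indep3 z (z \<star> z) (z \<star> (z \<star> z))")
    case True
    then obtain a b c where "z \<star> (z \<star> (z \<star> z)) = a \<odot> z + b \<odot> (z \<star> z) + c \<odot> (z \<star> (z \<star> z))"
      by (rule indep3_span)
    then show ?thesis
      by (intro exI[of _ a] exI[of _ b] exI[of _ c] exI[of _ "-1"]) simp
  next
    case False
    then obtain a b c where "a \<odot> z + b \<odot> (z \<star> z) + c \<odot> (z \<star> (z \<star> z)) = 0" "(a, b, c) \<noteq> (0, 0, 0)"
      unfolding indep3_def by blast
    then show ?thesis
      by (intro exI[of _ a] exI[of _ b] exI[of _ c] exI[of _ 0]) simp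
  qed
  then obtain a b c d where ne: "(a, b, c, d) \<noteq> (0, 0, 0, 0)"
    and rel: "a \<odot> z + b \<odot> (z \<star> z) + c \<odot> (z \<star> (z \<star> z)) + d \<odot> (z \<star> (z \<star> (z \<star> z))) = 0"
    by blast
  define w where "w = z \<star> (z \<star> z)"
  \<comment> \<open>With two further factors \<open>z\<close> the coefficient \<open>a\<close>
    belongs to \<open>w\<close>. If \<open>a = 0\<close>, fewer factors bring the next nonzero
    coefficient to \<open>w\<close>.\<close>
  have rel': "a \<odot> w + b \<odot> (z \<star> w) + c \<odot> (z \<star> (z \<star> w)) + d \<odot> (z \<star> (z \<star> (z \<star> w))) = 0"
    using arg_cong[OF rel, of "\<lambda>u. u \<star> (z \<star> z)"] by (simp add: assoc w_def)
  show thesis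
  proof (cases "z \<star> w = 0")
    case True
    then show ?thesis using that(1) by (simp add: w_def)
  next
    case False
    then have "w \<noteq> 0" by auto
    have "\<exists>\<alpha> \<beta> \<gamma>. \<alpha> \<odot> (z \<star> w) + \<beta> \<odot> (z \<star> (z \<star> w)) + \<gamma> \<odot> (z \<star> (z \<star> (z \<star> w))) = w"
    proof (cases "a = 0")
      case True
      show ?thesis
      proof (cases "b = 0")
        case True
        show ?thesis
        proof (cases "c = 0")
          case True
          then have "d \<noteq> 0" using ne \<open>a = 0\<close> \<open>b = 0\<close> by simp
          with rel \<open>a = 0\<close> \<open>b = 0\<close> \<open>c = 0\<close> have "z \<star> w = 0" by (simp add: w_def)
          with False show ?thesis by simp
        next
          case False
          have "c \<odot> w + d \<odot> (z \<star> w) = 0" using rel True \<open>a = 0\<close> by (simp add: w_def)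
          then have "c \<odot> w = - (d \<odot> (z \<star> w))" by (simp only: eq_neg_iff_add_eq_0)
          then have "(1 / c) \<odot> c \<odot> w = (1 / c) \<odot> - (d \<odot> (z \<star> w))" by simp
          then have "w = (- d / c) \<odot> (z \<star> w)" using False by simp
          then show ?thesis by (intro exI[of _ "- d / c"] exI[of _ 0]) simp
        qed
      next
        case False
        have "b \<odot> w + (c \<odot> (z \<star> w) + d \<odot> (z \<star> (z \<star> w))) = 0"
          using arg_cong[OF rel, of "\<lambda>u. u \<star> z"] \<open>a = 0\<close> by (simp add: assoc w_def algebra_simps)
        then have "b \<odot> w = - (c \<odot> (z \<star> w) + d \<odot> (z \<star> (z \<star> w)))" by (simp only: eq_neg_iff_add_eq_0)
        then have "(1 / b) \<odot> b \<odot> w = (1 / b) \<odot> - (c \<odot> (z \<star> w) + d \<odot> (z \<star> (z \<star> w)))" by simp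
        then have "w = (- c / b) \<odot> (z \<star> w) + (- d / b) \<odot> (z \<star> (z \<star> w))"
          using False by (simp add: scale_distribs)
        then show ?thesis by (intro exI[of _ "- c / b"] exI[of _ "- d / b"] exI[of _ 0]) simp
      qed
    next
      case False
      have "a \<odot> w + (b \<odot> (z \<star> w) + c \<odot> (z \<star> (z \<star> w)) + d \<odot> (z \<star> (z \<star> (z \<star> w)))) = 0"
        using rel' by (simp add: algebra_simps)
      then have "a \<odot> w = - (b \<odot> (z \<star> w) + c \<odot> (z \<star> (z \<star> w)) + d \<odot> (z \<star> (z \<star> (z \<star> w))))"
        by (simp only: eq_neg_iff_add_eq_0)
      then have "(1 / a) \<odot> a \<odot> w = (1 / a) \<odot> - (b \<odot> (z \<star> w) + c \<odot> (z \<star> (z \<star> w)) + d \<odot> (z \<star> (z \<star> (z \<star> w))))"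
        by simp
      then have "w = (- b / a) \<odot> (z \<star> w) + (- c / a) \<odot> (z \<star> (z \<star> w)) + (- d / a) \<odot> (z \<star> (z \<star> (z \<star> w)))"
        using False by (simp add: scale_distribs)
      then show ?thesis by metis
    qed
    then obtain \<alpha> \<beta> \<gamma> where
      *: "\<alpha> \<odot> (z \<star> w) + \<beta> \<odot> (z \<star> (z \<star> w)) + \<gamma> \<odot> (z \<star> (z \<star> (z \<star> w))) = w" by blast
    \<comment> \<open>The polynomial \<open>p\<close> in \<open>z\<close> acts as identity on \<open>z\<^sup>3\<close>, and \<open>p\<^sup>3\<close> is a multiple of \<open>z\<^sup>3\<close>; so \<open>p\<^sup>3\<close> is idempotent.\<close>
    define p where "p = \<alpha> \<odot> z + \<beta> \<odot> (z \<star> z) + \<gamma> \<odot> (z \<star> (z \<star> z))"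
    define T where "T y = \<alpha> \<odot> y + \<beta> \<odot> (z \<star> y) + \<gamma> \<odot> (z \<star> (z \<star> y))" for y
    have pw: "p \<star> w = w" using * by (simp add: p_def assoc)
    have pT: "p \<star> T y = T (p \<star> y)" for y
      by (simp add: p_def T_def assoc scale_distribs algebra_simps)
    have pz: "p \<star> y = T (z \<star> y)" "z \<star> T y = T (z \<star> y)" for y
      by (simp_all add: p_def T_def assoc)
    have p: "p = T z" by (simp add: p_def T_def)
    define g where "g = p \<star> (p \<star> p)"
    have "g = T (T (T w))" unfolding g_def by (subst (3) p) (simp add: pT pz w_def)
    then have pg: "p \<star> g = g" by (simp add: pT pw)
    have gg: "g \<star> g = g" unfolding g_def[of] by (simp add: assoc pg[unfolded g_def])
    have "g \<star> w = w" by (simp add: g_def assoc pw)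
    then have "g \<noteq> 0" using \<open>w \<noteq> 0\<close> by auto
    have "g = z \<star> T (p \<star> p)"
      unfolding pz(2) by (simp add: g_def pz(1)[symmetric])
    moreover have "g = (p \<star> (\<alpha> \<odot> p + \<beta> \<odot> (p \<star> z) + \<gamma> \<odot> (p \<star> (z \<star> z)))) \<star> z"
      unfolding g_def by (subst (3) p_def) (simp add: assoc)
    ultimately show ?thesis using that(2) \<open>g \<noteq> 0\<close> gg by blast
  qed
qed

section \<open>Two orthogonal idempotents\<close>

lemma listed_orthogonal_idempotents_unital:
  assumes f: "f \<star> f = f" and g: "g \<star> g = g" and fg: "f \<star> g = 0" "g \<star> f = 0"
    and ind: "indep3 f g x" and x: "f \<star> x = x" "x \<star> f = x" "g \<star> x = 0" "x \<star> g = 0"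
  shows listed
proof -
  interpret B: basis3 smul mul f g x by unfold_locales (rule ind)
  obtain a b c where xx: "x \<star> x = a \<odot> f + b \<odot> g + c \<odot> x"
    by (rule indep3_span[OF ind])
  have "g \<star> (x \<star> x) = 0" by (simp add: assoc[symmetric] x)
  then have "b \<odot> g = 0" by (simp add: xx g fg x)
  then have "b = 0" using arg_cong[of _ _ B.c2] by fastforce
  \<comment> \<open>Completing the square in the corner of \<open>f\<close>, which is spanned by
    \<open>f\<close> and \<open>x\<close>. If \<open>\<delta>\<close> is nonzero, \<open>f\<close>
    splits into two idempotents with the help of a square root of \<open>\<delta>\<close>; otherwise
    \<open>y\<close> is nilpotent.\<close>
  define y where "y = x - (c / 2) \<odot> f"
  define \<delta> where "\<delta> = a + c\<^sup>2 / 4"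
  have y: "f \<star> y = y" "y \<star> f = y" "g \<star> y = 0" "y \<star> g = 0"
    by (simp_all add: y_def x f fg)
  have yy: "y \<star> y = \<delta> \<odot> f"
    unfolding B.vec_eq by (simp add: y_def xx x f \<open>b = 0\<close> \<delta>_def power2_eq_square field_simps)
  show ?thesis
  proof (cases "\<delta> = 0")
    case True
    have "indep3 g f y"
      by (rule B.indep3_coordsI) (simp add: y_def)
    then show ?thesis
      by (rule A08) (simp_all add: f g fg y yy True)
  next
    case False
    define s where "s = csqrt \<delta>"
    have s: "s * s = \<delta>" "s \<noteq> 0" using False by (auto simp: s_def power2_eq_square[symmetric])
    define p where "p = (1 / 2) \<odot> f + (1 / (2 * s)) \<odot> y"
    define q where "q = (1 / 2) \<odot> f - (1 / (2 * s)) \<odot> y"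
    have "indep3 p q g"
      by (rule B.indep3_coordsI) (use s in \<open>auto simp: p_def q_def y_def field_simps\<close>)
    then show ?thesis
      by (rule A07; unfold B.vec_eq)
        (use s in \<open>simp_all add: p_def q_def f g fg y yy s(1)[symmetric] field_simps\<close>)
  qed
qed

text \<open>The third basis vector can be a common eigenvector of all multiplications by
  \<open>f\<close> and \<open>g\<close>, because the Peirce components of a vector outside their
  span cannot all lie in the span. It remains to go through the nine Peirce types.\<close>

lemma listed_orthogonal_idempotents:
  assumes f: "f \<star> f = f" "f \<noteq> 0" and g: "g \<star> g = g" "g \<noteq> 0" and fg: "f \<star> g = 0" "g \<star> f = 0"
  shows listed
proof -
  define S where "S = span {f, g}"
  have S: "subspace S" "f \<in> S" "g \<in> S" by (auto simp: S_def span_base)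
  have Sadd: "u + v \<in> S" if "u \<in> S" "v \<in> S" for u v using S(1) that by (rule subspace_add)
  obtain w where w: "\<And>a b. w \<noteq> a \<odot> f + b \<odot> g" using outside_span2 by blast
  have S_iff: "v \<in> S \<longleftrightarrow> (\<exists>a b. v = a \<odot> f + b \<odot> g)" for v
    unfolding S_def by (rule span_pair_iff)
  have "w \<notin> S" using w by (simp add: S_iff)
  obtain x1 where x1: "x1 \<notin> S" and l1: "f \<star> x1 = x1 \<and> g \<star> x1 = 0 \<or> f \<star> x1 = 0 \<and> g \<star> x1 = x1
     \<or> f \<star> x1 = 0 \<and> g \<star> x1 = 0"
  proof -
    have "(w - f \<star> w - g \<star> w) + (f \<star> w + g \<star> w) \<notin> S" using \<open>w \<notin> S\<close> by simp
    then consider "f \<star> w \<notin> S" | "g \<star> w \<notin> S" | "w - f \<star> w - g \<star> w \<notin> S"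
      using Sadd by blast
    then show thesis
      by cases (rule that, assumption, simp add: assoc[symmetric] f g fg)+
  qed
  obtain x where x: "x \<notin> S" and l: "f \<star> x = x \<and> g \<star> x = 0 \<or> f \<star> x = 0 \<and> g \<star> x = x
     \<or> f \<star> x = 0 \<and> g \<star> x = 0" and r: "x \<star> f = x \<and> x \<star> g = 0 \<or> x \<star> f = 0 \<and> x \<star> g = x
     \<or> x \<star> f = 0 \<and> x \<star> g = 0"
  proof -
    have "(x1 - x1 \<star> f - x1 \<star> g) + (x1 \<star> f + x1 \<star> g) \<notin> S" using x1 by simp
    then consider "x1 \<star> f \<notin> S" | "x1 \<star> g \<notin> S" | "x1 - x1 \<star> f - x1 \<star> g \<notin> S"
      using Sadd by blast
    then show thesis
    proof cases
      case 1
      show ?thesis by (rule that[OF 1]) (use l1 in \<open>auto simp: assoc f g fg\<close>, auto simp: assoc[symmetric])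
    next
      case 2
      show ?thesis by (rule that[OF 2]) (use l1 in \<open>auto simp: assoc f g fg\<close>, auto simp: assoc[symmetric])
    next
      case 3
      show ?thesis by (rule that[OF 3]) (use l1 in \<open>auto simp: assoc f g fg\<close>, auto simp: assoc[symmetric])
    qed
  qed
  have fg_ind: "g \<noteq> a \<odot> f" for a
  proof
    assume "g = a \<odot> f"
    with fg f have "a \<odot> f = 0" by (metis mul_simps(10))
    with \<open>g = a \<odot> f\<close> g show False by simp
  qed
  have ind: "indep3 f g x"
    using f fg_ind x by (intro indep3I) (auto simp: S_iff)
  then interpret B: basis3 smul mul f g x by unfold_locales
  have ind': "indep3 g f x"
    by (rule B.indep3_coordsI) simp
  note ff = f(1) g(1) fg
  \<comment> \<open>When \<open>f\<close> or \<open>g\<close> fixes \<open>x\<close> on one side and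
    kills it on the other, the square vanishes by moving the idempotent across, as in
    \<open>x (f x) = (x f) x\<close>.\<close>
  have sq: "x \<star> x = 0" if "f \<star> x = x \<and> x \<star> f = 0 \<or> g \<star> x = x \<and> x \<star> g = 0 \<or>
      f \<star> x = 0 \<and> x \<star> f = x \<or> g \<star> x = 0 \<and> x \<star> g = x"
    using that assoc[of x f x] assoc[of x g x] by auto
  show ?thesis
  proof (cases "f \<star> x = 0 \<and> g \<star> x = 0 \<and> x \<star> f = 0 \<and> x \<star> g = 0")
    case True
    obtain a b c where xx: "x \<star> x = a \<odot> f + b \<odot> g + c \<odot> x"
      by (rule indep3_span[OF ind])
    have "g \<star> (x \<star> x) = 0" "f \<star> (x \<star> x) = 0" by (simp_all add: assoc[symmetric] True)
    then have "b \<odot> g = 0" "a \<odot> f = 0" by (simp_all add: xx ff True)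
    then have "x \<star> x = c \<odot> x" using f g xx by auto
    show ?thesis
    proof (cases "c = 0")
      case True2: True
      show ?thesis by (rule A01[OF ind]) (simp_all add: ff True \<open>x \<star> x = c \<odot> x\<close> True2)
    next
      case False
      have "indep3 f g ((1/c) \<odot> x)"
        by (rule B.indep3_coordsI) (use False in simp)
      then show ?thesis
        by (rule A07) (simp_all add: ff True \<open>x \<star> x = c \<odot> x\<close> False)
    qed
  next
    case False
    then consider "f \<star> x = x" "g \<star> x = 0" "x \<star> f = x" "x \<star> g = 0"
      | "f \<star> x = 0" "g \<star> x = x" "x \<star> f = 0" "x \<star> g = x"
      | "f \<star> x = x" "g \<star> x = 0" "x \<star> f = 0" "x \<star> g = x" "x \<star> x = 0"
      | "f \<star> x = 0" "g \<star> x = x" "x \<star> f = x" "x \<star> g = 0" "x \<star> x = 0"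
      | "f \<star> x = x" "g \<star> x = 0" "x \<star> f = 0" "x \<star> g = 0" "x \<star> x = 0"
      | "f \<star> x = 0" "g \<star> x = x" "x \<star> f = 0" "x \<star> g = 0" "x \<star> x = 0"
      | "f \<star> x = 0" "g \<star> x = 0" "x \<star> f = x" "x \<star> g = 0" "x \<star> x = 0"
      | "f \<star> x = 0" "g \<star> x = 0" "x \<star> f = 0" "x \<star> g = x" "x \<star> x = 0"
      using l r sq by argo
    then show ?thesis
    proof cases
      case 1
      then show ?thesis by (intro listed_orthogonal_idempotents_unital[OF _ _ _ _ ind]) (simp_all add: ff)
    next
      case 2
      then show ?thesis by (intro listed_orthogonal_idempotents_unital[OF _ _ _ _ ind']) (simp_all add: ff)
    next
      case 3
      then show ?thesis by (intro A20[OF ind]) (simp_all add: ff)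
    next
      case 4
      then show ?thesis by (intro A20[OF ind']) (simp_all add: ff)
    next
      case 5
      then show ?thesis by (intro A23[OF ind]) (simp_all add: ff)
    next
      case 6
      then show ?thesis by (intro A23[OF ind']) (simp_all add: ff)
    next
      case 7
      then show ?thesis by (intro A24[OF ind]) (simp_all add: ff)
    next
      case 8
      then show ?thesis by (intro A24[OF ind']) (simp_all add: ff)
    qed
  qed
qed

section \<open>Nilpotent elements in the corner of an idempotent\<close>

lemma power4_zero_quadratic:
  assumes z: "z \<star> (z \<star> (z \<star> z)) = 0" and zz: "z \<star> z = \<alpha> \<odot> f + \<beta> \<odot> z"
    and f: "f \<star> f = f" "f \<star> z = z" "z \<star> f = z" and ind: "\<And>a. z \<noteq> a \<odot> f" "f \<noteq> 0"
  shows "z \<star> z = 0"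
proof -
  have indD: "a = 0 \<and> b = 0" if "a \<odot> f + b \<odot> z = 0" for a b
  proof -
    have "b = 0"
    proof (rule ccontr)
      assume "b \<noteq> 0"
      have "b \<odot> z = - (a \<odot> f)" using that by (simp only: eq_neg_iff_add_eq_0 add.commute)
      then have "(1 / b) \<odot> b \<odot> z = (1 / b) \<odot> - (a \<odot> f)" by simp
      then have "z = (- a / b) \<odot> f" using \<open>b \<noteq> 0\<close> by simp
      with ind(1) show False by blast
    qed
    with that ind(2) show ?thesis by simp
  qed
  have "(z \<star> z) \<star> (z \<star> z) = 0" using z by (simp add: assoc)
  then have "(\<alpha> * \<alpha>) \<odot> f + (\<alpha> * \<beta>) \<odot> z + (\<alpha> * \<beta>) \<odot> z
      + (\<alpha> * (\<beta> * \<beta>)) \<odot> f + (\<beta> * (\<beta> * \<beta>)) \<odot> z = 0"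
    by (simp add: zz f scale_distribs algebra_simps)
  then have "(\<alpha> * \<alpha> + \<alpha> * (\<beta> * \<beta>)) \<odot> f + (\<alpha> * \<beta> + \<alpha> * \<beta> + \<beta> * (\<beta> * \<beta>)) \<odot> z = 0"
    by (simp only: scale_left_distrib add_ac)
  \<comment> \<open>These are the coefficients of \<open>f\<close> and \<open>z\<close> in the
    square of \<open>z z\<close>; the only common zero of the two polynomials is
    \<open>\<alpha> = \<beta> = 0\<close>.\<close>
  from indD[OF this] have 1: "\<alpha> * (\<alpha> + \<beta> * \<beta>) = 0" "\<beta> * (2 * \<alpha> + \<beta> * \<beta>) = 0" by (simp_all add: algebra_simps)
  have "\<alpha> = 0 \<and> \<beta> = 0"
  proof (cases "\<beta> = 0")
    case False
    then have "\<beta> * \<beta> = - 2 * \<alpha>" using 1(2) by (simp add: eq_neg_iff_add_eq_0 add.commute)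
    then have "\<alpha> * \<alpha> = 0" using 1(1) by simp
    then show ?thesis using \<open>\<beta> * \<beta> = - 2 * \<alpha>\<close> by simp
  qed (use 1 in simp)
  then show ?thesis by (simp add: zz)
qed

text \<open>An eigenvalue of left multiplication by \<open>x\<close>, found without determinants:
  \<open>\<mu>\<close> is a root of a polynomial annihilating \<open>x\<close>, and the
  complementary factor, evaluated at \<open>x\<close>, is the eigenvector.\<close>

lemma shift_eigenvector:
  assumes f: "f \<star> f = f" "f \<noteq> 0" and x: "f \<star> x = x" "x \<star> f = x"
  obtains \<mu> y where "y \<noteq> 0" "f \<star> y = y" "(x - \<mu> \<odot> f) \<star> y = 0"
proof (cases "indep3 f x (x \<star> x)")
  case True
  then obtain a b c where xxx: "x \<star> (x \<star> x) = a \<odot> f + b \<odot> x + c \<odot> (x \<star> x)"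
    by (rule indep3_span)
  have "\<not> constant (poly [:- a, - b, - c, 1:])"
    by (simp add: constant_degree)
  then obtain \<mu> where "poly [:- a, - b, - c, 1:] \<mu> = 0"
    using fundamental_theorem_of_algebra by blast
  then have \<mu>: "\<mu> * (\<mu> * (\<mu> - c) - b) = a"
    by (simp add: algebra_simps)
  \<comment> \<open>The quotient of \<open>t^3 - c t^2 - b t - a\<close> by
    \<open>t - \<mu>\<close>, evaluated at \<open>x\<close> with \<open>f\<close> in place of
    1.\<close>
  define y where "y = x \<star> x + (\<mu> - c) \<odot> x + (\<mu> * (\<mu> - c) - b) \<odot> f"
  have "(x - \<mu> \<odot> f) \<star> y = a \<odot> f - (\<mu> * (\<mu> * (\<mu> - c) - b)) \<odot> f"
    by (simp add: y_def xxx f x assoc[symmetric] scale_distribs) (simp add: xxx assoc x scale_distribs algebra_simps)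
  then have "(x - \<mu> \<odot> f) \<star> y = 0" by (simp add: \<mu>)
  moreover have "y \<noteq> 0"
    using indep3D[OF True, of "\<mu> * (\<mu> - c) - b" "\<mu> - c" 1] by (auto simp: y_def add_ac)
  moreover have "f \<star> y = y" by (simp add: y_def f x assoc[symmetric])
  ultimately show thesis using that by blast
next
  case False
  then obtain a b c where rel: "a \<odot> f + b \<odot> x + c \<odot> (x \<star> x) = 0" and ne: "(a, b, c) \<noteq> (0, 0, 0)"
    unfolding indep3_def by blast
  note result = that
  \<comment> \<open>If \<open>x\<close> is a multiple of \<open>f\<close>, then \<open>f\<close>
    itself is an eigenvector. This settles a linear relation as well as a complementary factor that
    vanishes at \<open>x\<close>.\<close>
  have scalar: thesis if "d \<odot> x = u \<odot> f" "d \<noteq> 0" for d u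
  proof -
    have "(1 / d) \<odot> d \<odot> x = (1 / d) \<odot> u \<odot> f" using that(1) by simp
    then have "x = (u / d) \<odot> f" using that(2) by simp
    then show thesis by (intro result[of f "u / d"]) (simp_all add: f)
  qed
  show thesis
  proof (cases "c = 0")
    case True
    with rel have "b \<odot> x = (- a) \<odot> f" by (simp add: eq_neg_iff_add_eq_0 add.commute)
    moreover have "b \<noteq> 0"
      using rel ne f(2) True by auto
    ultimately show thesis by (rule scalar)
  next
    case False
    have "\<not> constant (poly [:a, b, c:])"
      using False by (simp add: constant_degree)
    then obtain \<mu> where "poly [:a, b, c:] \<mu> = 0"
      using fundamental_theorem_of_algebra by blast
    then have \<mu>: "a = - (\<mu> * (\<mu> * c + b))"
      by (simp add: algebra_simps eq_neg_iff_add_eq_0)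
    define y where "y = c \<odot> x + (c * \<mu> + b) \<odot> f"
    have "(x - \<mu> \<odot> f) \<star> y = a \<odot> f + b \<odot> x + c \<odot> (x \<star> x)"
      by (simp add: y_def x f \<mu> scale_distribs algebra_simps)
    with rel have y: "(x - \<mu> \<odot> f) \<star> y = 0" by simp
    show thesis
    proof (cases "y = 0")
      case True
      then have "c \<odot> x = (- (c * \<mu> + b)) \<odot> f"
        by (simp add: y_def eq_neg_iff_add_eq_0 del: minus_add_distrib)
      then show thesis using False by (rule scalar)
    next
      case False
      moreover have "f \<star> y = y" by (simp add: y_def f x)
      ultimately show thesis using y that by blast
    qed
  qed
qed

text \<open>If all squares in the plane vanish, its product is anticommutative, and multiplying
  \<open>x y = a x + b y\<close> by \<open>x\<close> on the left and \<open>y\<close> on the right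
  gives zero. Otherwise some \<open>z\<close> and its square span the plane, and
  \<open>z^4 = 0\<close> improves to \<open>z^3 = 0\<close>. The vector \<open>f\<close> marks a
  complement: the plane is where the first coordinate is zero.\<close>

lemma nil_plane:
  assumes ind: "indep3 f x y"
    and closed: "\<And>u v. u \<in> span {x, y} \<Longrightarrow> v \<in> span {x, y} \<Longrightarrow> u \<star> v \<in> span {x, y}"
    and nil: "\<And>u. u \<in> span {x, y} \<Longrightarrow> u \<star> (u \<star> (u \<star> u)) = 0"
  obtains "x \<star> x = 0" "x \<star> y = 0" "y \<star> x = 0" "y \<star> y = 0"
  | z where "z \<in> span {x, y}" "indep3 f z (z \<star> z)" "z \<star> (z \<star> z) = 0"
proof (cases "\<forall>z \<in> span {x, y}. z \<star> z = 0")
  case True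
  have xy: "x \<in> span {x, y}" "y \<in> span {x, y}" by (simp_all add: span_base)
  have sq: "x \<star> x = 0" "y \<star> y = 0" "(x + y) \<star> (x + y) = 0"
    using True xy span_add[OF xy] by blast+
  then have yx: "y \<star> x = - (x \<star> y)" by (simp add: eq_neg_iff_add_eq_0)
  obtain a b where prod: "x \<star> y = a \<odot> x + b \<odot> y"
    using closed[OF xy] unfolding span_pair_iff by blast
  have "x \<star> (x \<star> y) = 0" "(x \<star> y) \<star> y = 0" by (simp add: assoc[symmetric] sq, simp add: assoc sq)
  then have "b \<odot> (x \<star> y) = 0" "a \<odot> (x \<star> y) = 0"
    by (simp_all only: prod mul_simps) (simp_all add: sq prod)
  then have "x \<star> y = 0" using prod by auto
  then show thesis using that(1) sq yx by simp
next
  case False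
  then obtain z where z: "z \<in> span {x, y}" "z \<star> z \<noteq> 0" by blast
  interpret B: basis3 smul mul f x y by unfold_locales (rule ind)
  have span_iff: "u \<in> span {x, y} \<longleftrightarrow> B.c1 u = 0" for u
  proof
    show "u \<in> span {x, y} \<Longrightarrow> B.c1 u = 0"
      unfolding span_pair_iff by auto
    show "B.c1 u = 0 \<Longrightarrow> u \<in> span {x, y}"
      unfolding span_pair_iff using B.expand[of u] by auto
  qed
  have zz: "z \<star> z \<in> span {x, y}" "z \<star> (z \<star> z) \<in> span {x, y}"
    using closed z by blast+
  have z4: "z \<star> (z \<star> (z \<star> z)) = 0" using nil z by blast
  have ind': "indep3 f z (z \<star> z)"
    unfolding indep3_def
  proof (intro allI impI)
    fix a b c assume eq: "a \<odot> f + b \<odot> z + c \<odot> (z \<star> z) = 0"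
    have "a = 0" using arg_cong[OF eq, of B.c1] z zz by (simp add: span_iff)
    have "z \<star> (z \<star> (a \<odot> f + b \<odot> z + c \<odot> (z \<star> z))) = 0" "z \<star> (a \<odot> f + b \<odot> z + c \<odot> (z \<star> z)) = 0"
      unfolding eq by simp_all
    then have "b \<odot> (z \<star> (z \<star> z)) = 0" and *: "b \<odot> (z \<star> z) + c \<odot> (z \<star> (z \<star> z)) = 0"
      by (simp_all add: \<open>a = 0\<close> z4)
    then have "b = 0" using z(2) by auto
    with eq \<open>a = 0\<close> z(2) show "a = 0 \<and> b = 0 \<and> c = 0" by simp
  qed
  obtain a b c where zzz: "z \<star> (z \<star> z) = a \<odot> f + b \<odot> z + c \<odot> (z \<star> z)"
    by (rule indep3_span[OF ind'])
  have "a = 0" using arg_cong[OF zzz, of B.c1] z zz by (simp add: span_iff)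
  have "z \<star> (a \<odot> f + b \<odot> z + c \<odot> (z \<star> z)) = 0" using z4 by (simp only: zzz)
  then have "0 \<odot> f + (c * b) \<odot> z + (b + c * c) \<odot> (z \<star> z) = 0"
    by (simp add: \<open>a = 0\<close>) (simp add: zzz \<open>a = 0\<close> scale_distribs algebra_simps)
  from indep3D[OF ind' this] have "c * b = 0" "b + c * c = 0" by auto
  then have "b = 0 \<and> c = 0" by auto
  then show thesis using that(2) z ind' zzz \<open>a = 0\<close> by simp
qed

end

text \<open>An idempotent violating one of the last two assumptions yields two orthogonal nonzero
  idempotents, \<open>f, g\<close> or \<open>g, f - g\<close>, a case already settled. The
  assumptions make the corner of \<open>f\<close> local and the component annihilated by
  \<open>f\<close> on both sides nil.\<close>

locale one_idempotent = assoc3 smul mul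
  for smul :: "complex \<Rightarrow> 'a::ab_group_add \<Rightarrow> 'a" (infixr "\<odot>" 80)
    and mul :: "'a \<Rightarrow> 'a \<Rightarrow> 'a" (infixl "\<star>" 75) +
  fixes f
  assumes idem: "f \<star> f = f" "f \<noteq> 0"
    and no_orth: "g \<star> g = g \<Longrightarrow> f \<star> g = 0 \<Longrightarrow> g \<star> f = 0 \<Longrightarrow> g = 0"
    and no_split: "g \<star> g = g \<Longrightarrow> f \<star> g = g \<Longrightarrow> g \<star> f = g \<Longrightarrow> g = 0 \<or> g = f"
begin

lemma shift_nilpotent:
  assumes x: "f \<star> x = x" "x \<star> f = x"
  obtains \<mu> z where "x = \<mu> \<odot> f + z" "z \<star> (z \<star> (z \<star> z)) = 0" "f \<star> z = z" "z \<star> f = z"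
proof -
  obtain \<mu> y where y: "y \<noteq> 0" "f \<star> y = y" "(x - \<mu> \<odot> f) \<star> y = 0"
    by (rule shift_eigenvector[OF idem x])
  define z where "z = x - \<mu> \<odot> f"
  have z: "f \<star> z = z" "z \<star> f = z" by (simp_all add: z_def x idem)
  show thesis
  proof (rule nilpotent_or_idempotent[of z])
    assume "z \<star> (z \<star> (z \<star> z)) = 0"
    moreover have "x = \<mu> \<odot> f + z" by (simp add: z_def)
    ultimately show thesis using z that by blast
  next
    fix g h h' assume g: "g \<noteq> 0" "g \<star> g = g" "g = z \<star> h" "g = h' \<star> z"
    have "f \<star> g = g" using g(3) z by (simp add: assoc[symmetric])
    moreover have "g \<star> f = g" using g(4) z by (simp add: assoc)
    \<comment> \<open>The eigenvector \<open>y\<close> is killed by \<open>z\<close>, hence by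
      \<open>g\<close>, but fixed by \<open>f\<close>.\<close>
    moreover have "g \<noteq> f"
    proof
      assume "g = f"
      have "g \<star> y = 0" using g(4) y(3) by (simp add: assoc z_def)
      with \<open>g = f\<close> y show False by simp
    qed
    ultimately show thesis using no_split g by blast
  qed
qed

lemma nilpotent_00:
  assumes "f \<star> x = 0" "x \<star> f = 0"
  shows "x \<star> (x \<star> (x \<star> x)) = 0"
proof (rule nilpotent_or_idempotent[of x])
  fix g h h' assume g: "g \<noteq> 0" "g \<star> g = g" "g = x \<star> h" "g = h' \<star> x"
  have "f \<star> g = 0" using g(3) assms by (simp add: assoc[symmetric])
  moreover have "g \<star> f = 0" using g(4) assms by (simp add: assoc)
  ultimately show ?thesis using no_orth g by blast
qed

lemma shifted_inverse:
  assumes n: "n \<star> (n \<star> (n \<star> n)) = 0" "f \<star> n = n" "n \<star> f = n" and "\<mu> \<noteq> 0"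
  obtains r where "(\<mu> \<odot> f + n) \<star> r = f" "f \<star> r = r" "r \<star> f = r"
proof -
  define m where "m = (1 / \<mu>) \<odot> n"
  have m: "m \<star> (m \<star> (m \<star> m)) = 0" "f \<star> m = m" "m \<star> f = m" "n = \<mu> \<odot> m"
    using n \<open>\<mu> \<noteq> 0\<close> by (simp_all add: m_def)
  have "f \<star> (m \<star> m) = m \<star> m" "f \<star> (m \<star> (m \<star> m)) = m \<star> (m \<star> m)"
     by (simp_all add: m assoc[symmetric])
  note m = m this
  \<comment> \<open>The geometric series for the inverse of \<open>f + m\<close>, which breaks off
    because \<open>m^4 = 0\<close>.\<close>
  have "(\<mu> \<odot> f + n) \<star> ((1 / \<mu>) \<odot> (f - m + m \<star> m - m \<star> (m \<star> m))) = f"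
    using \<open>\<mu> \<noteq> 0\<close> by (simp add: m idem scale_distribs)
  then show thesis by (rule that) (simp_all add: m idem assoc)
qed

text \<open>A right inverse \<open>r\<close> would give \<open>p^4 r^4 = f\<close>, although
  \<open>p^4 = 0\<close>.\<close>

lemma nilpotent_not_invertible:
  assumes p: "p \<star> (p \<star> (p \<star> p)) = 0" "p \<star> f = p" and r: "f \<star> r = r"
  shows "p \<star> r \<noteq> f"
proof
  assume pr: "p \<star> r = f"
  then have *: "p \<star> (r \<star> s) = s" if "f \<star> s = s" for s
    using that by (simp add: assoc[symmetric])
  have **: "f \<star> (r \<star> s) = r \<star> s" for s using r by (simp add: assoc[symmetric])
  have "f = p \<star> (p \<star> (p \<star> (p \<star> (r \<star> (r \<star> (r \<star> r))))))"
    by (simp add: * ** r pr)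
  also have "\<dots> = (p \<star> (p \<star> (p \<star> p))) \<star> (r \<star> (r \<star> (r \<star> r)))"
    by (simp only: assoc)
  also have "\<dots> = 0" by (simp add: p)
  finally show False using idem by simp
qed

abbreviation corner_nil :: "'a \<Rightarrow> bool" where
  "corner_nil x \<equiv> f \<star> x = x \<and> x \<star> f = x \<and> x \<star> (x \<star> (x \<star> x)) = 0"

lemma corner_nil_or_unit:
  assumes "f \<star> x = x" "x \<star> f = x"
  obtains "corner_nil x" | r where "x \<star> r = f" "f \<star> r = r" "r \<star> f = r"
proof -
  obtain \<mu> z where z: "x = \<mu> \<odot> f + z" "z \<star> (z \<star> (z \<star> z)) = 0" "f \<star> z = z" "z \<star> f = z"
    using shift_nilpotent[OF assms] by blast
  show thesis
  proof (cases "\<mu> = 0")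
    case True
    then show thesis using z that(1) by simp
  next
    case False
    show thesis using shifted_inverse[OF z(2-4) False] that(2) unfolding z(1) by blast
  qed
qed

lemma corner_nil_mult:
  assumes "corner_nil p" "f \<star> q = q" "q \<star> f = q"
  shows "corner_nil (p \<star> q)"
proof (rule corner_nil_or_unit[of "p \<star> q"])
  show "f \<star> (p \<star> q) = p \<star> q" "p \<star> q \<star> f = p \<star> q" using assms by (simp add: assoc[symmetric], simp add: assoc)
  fix r assume r: "p \<star> q \<star> r = f" "f \<star> r = r"
  have "f \<star> (q \<star> r) = q \<star> r" using assms by (simp add: assoc[symmetric])
  then have "p \<star> (q \<star> r) \<noteq> f" using assms by (intro nilpotent_not_invertible) auto
  then show ?thesis using r by (simp add: assoc)
qed

text \<open>The local ring argument: if \<open>r\<close> were a right inverse of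
  \<open>x + y\<close>, then \<open>y r = f - x r\<close> would be invertible by
  \<open>shifted_inverse\<close>, and the nilpotent \<open>y\<close> would have a right
  inverse.\<close>

lemma corner_nil_add:
  assumes "corner_nil x" "corner_nil y"
  shows "corner_nil (x + y)"
proof (rule corner_nil_or_unit[of "x + y"])
  show "f \<star> (x + y) = x + y" "(x + y) \<star> f = x + y" using assms by simp_all
  fix r assume r: "(x + y) \<star> r = f" "f \<star> r = r" "r \<star> f = r"
  define m where "m = (- 1) \<odot> (x \<star> r)"
  have "corner_nil (x \<star> r)" using corner_nil_mult assms r by blast
  then have m: "corner_nil m" by (simp add: m_def)
  then obtain s where s: "(1 \<odot> f + m) \<star> s = f" "f \<star> s = s"
    using shifted_inverse[of m 1] by auto
  have "y \<star> r = 1 \<odot> f + m" using r by (simp add: m_def algebra_simps)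
  then have "y \<star> (r \<star> s) = f" using s by (simp add: assoc[symmetric])
  moreover have "f \<star> (r \<star> s) = r \<star> s" using r by (simp add: assoc[symmetric])
  ultimately show ?thesis using nilpotent_not_invertible assms by blast
qed

lemma corner_nil_scale: "corner_nil x \<Longrightarrow> corner_nil (c \<odot> x)"
  by simp

lemma corner_nil_f: "corner_nil (c \<odot> f) \<Longrightarrow> c = 0"
  using idem by simp

definition piece :: "complex \<Rightarrow> complex \<Rightarrow> 'a \<Rightarrow> bool" where
  "piece a b x \<longleftrightarrow> f \<star> x = a \<odot> x \<and> x \<star> f = b \<odot> x \<and> x \<star> (x \<star> (x \<star> x)) = 0"

text \<open>Splitting by left and then by right multiplication by \<open>f\<close> leaves a Peirce
  component outside \<open>S\<close>. Nilpotency can be arranged: in the corner a multiple of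
  \<open>f\<close>, which lies in \<open>S\<close>, is subtracted; in the other types it is
  automatic.\<close>

lemma piece_exists:
  assumes S: "subspace S" "f \<in> S" and w: "w \<notin> S"
  obtains x a b where "x \<notin> S" "a \<in> {0, 1}" "b \<in> {0, 1}" "piece a b x"
proof -
  have Sadd: "u + v \<in> S" if "u \<in> S" "v \<in> S" for u v using S(1) that by (rule subspace_add)
  obtain x1 a where x1: "x1 \<notin> S" "a \<in> {0, 1}" "f \<star> x1 = a \<odot> x1"
  proof (cases "f \<star> w \<in> S")
    case True
    then have "w - f \<star> w \<notin> S" using Sadd[of "w - f \<star> w" "f \<star> w"] w by auto
    then show thesis by (rule that[of _ 0]) (simp_all add: assoc[symmetric] idem)
  next
    case False
    then show thesis by (rule that[of _ 1]) (simp_all add: assoc[symmetric] idem)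
  qed
  obtain x b where x: "x \<notin> S" "b \<in> {0, 1}" "f \<star> x = a \<odot> x" "x \<star> f = b \<odot> x"
  proof (cases "x1 \<star> f \<in> S")
    case True
    then have "x1 - x1 \<star> f \<notin> S" using Sadd[of "x1 - x1 \<star> f" "x1 \<star> f"] x1 by auto
    then show thesis
      by (rule that[of _ 0]) (simp_all add: assoc idem x1, simp_all add: assoc[symmetric] x1 scale_distribs)
  next
    case False
    then show thesis
      by (rule that[of _ 1]) (simp_all add: assoc idem x1, simp_all add: assoc[symmetric] x1)
  qed
  consider "a = 1" "b = 1" | "a = 0" "b = 0" | "a = 1" "b = 0" | "a = 0" "b = 1"
    using x x1 by auto
  then show thesis
  proof cases
    case 1
    then obtain \<mu> z where z: "x = \<mu> \<odot> f + z" "z \<star> (z \<star> (z \<star> z)) = 0" "f \<star> z = z" "z \<star> f = z"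
      using shift_nilpotent[of x] x by auto
    have "z \<notin> S" using x(1) z(1) Sadd[of "\<mu> \<odot> f" z] S subspace_scale[OF S(1)] by blast
    then show thesis by (rule that[of z 1 1]) (simp_all add: piece_def z)
  next
    case 2
    then show thesis using x nilpotent_00[of x] by (intro that[of x 0 0]) (simp_all add: piece_def)
  next
    case 3
    then have "x \<star> x = 0" using x assoc[of x f x] by simp
    then show thesis using x 3 by (intro that[of x 1 0]) (simp_all add: piece_def)
  next
    case 4
    then have "x \<star> x = 0" using x assoc[of x f x] by simp
    then show thesis using x 4 by (intro that[of x 0 1]) (simp_all add: piece_def)
  qed
qed

lemma piece_mult_zero:
  assumes "piece a b x" "piece c d y" "b \<noteq> c"
  shows "x \<star> y = 0"
proof -
  have "b \<odot> (x \<star> y) = c \<odot> (x \<star> y)"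
    using assoc[of x f y] assms unfolding piece_def by simp
  then show ?thesis using assms by simp
qed

text \<open>Both eigenvalue equations are compared coordinate by coordinate; \<open>f\<close> itself
  counts as type \<open>(1, 1)\<close>.\<close>

lemma eigen_comb:
  assumes ind: "indep3 f x y" and p: "piece ax bx x" "piece ay by' y"
    and w: "f \<star> w = a \<odot> w" "w \<star> f = b \<odot> w"
  obtains \<alpha> \<beta> \<gamma> where "w = \<alpha> \<odot> f + \<beta> \<odot> x + \<gamma> \<odot> y" "(a, b) \<noteq> (1, 1) \<Longrightarrow> \<alpha> = 0"
    "(a, b) \<noteq> (ax, bx) \<Longrightarrow> \<beta> = 0" "(a, b) \<noteq> (ay, by') \<Longrightarrow> \<gamma> = 0"
proof -
  interpret B: basis3 smul mul f x y by unfold_locales (rule ind)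
  obtain \<alpha> \<beta> \<gamma> where *: "w = \<alpha> \<odot> f + \<beta> \<odot> x + \<gamma> \<odot> y"
    by (rule indep3_span[OF ind])
  have "\<alpha> = a * \<alpha> \<and> \<beta> * ax = a * \<beta> \<and> \<gamma> * ay = a * \<gamma>"
    "\<alpha> = b * \<alpha> \<and> \<beta> * bx = b * \<beta> \<and> \<gamma> * by' = b * \<gamma>"
    using w p unfolding * piece_def by (simp_all add: B.vec_eq idem)
  then show thesis using * by (intro that[of \<alpha> \<beta> \<gamma>]) auto
qed

lemma nil_left_scalar:
  assumes "x \<star> (x \<star> (x \<star> x)) = 0" "x \<star> y = c \<odot> y"
  shows "x \<star> y = 0"
proof -
  have "(x \<star> (x \<star> (x \<star> x))) \<star> y = (c * c * c * c) \<odot> y" by (simp add: assoc assms(2))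
  then show ?thesis using assms by auto
qed

lemma nil_right_scalar:
  assumes "x \<star> (x \<star> (x \<star> x)) = 0" "y \<star> x = c \<odot> y"
  shows "y \<star> x = 0"
proof -
  have "y \<star> (x \<star> (x \<star> (x \<star> x))) = (c * c * c * c) \<odot> y" by (simp add: assoc[symmetric] assms(2))
  then show ?thesis using assms by auto
qed

lemma piece_mult:
  assumes "piece a b x" "piece c d y"
  shows "f \<star> (x \<star> y) = a \<odot> (x \<star> y)" "(x \<star> y) \<star> f = d \<odot> (x \<star> y)"
  using assms assoc[of f x y] assoc[of x y f] by (simp_all add: piece_def)

text \<open>Since \<open>y\<close> has another type, the square of \<open>x\<close> lies in the span
  of \<open>x\<close> and, for type \<open>(1, 1)\<close>, of \<open>f\<close>; nilpotency then
  leaves only zero. Mixed types square to zero by \<open>piece_mult_zero\<close>.\<close>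

lemma piece_square:
  assumes ind: "indep3 f x y" and p: "piece a b x" "piece c d y" and ne: "(a, b) \<noteq> (c, d)"
    and ab: "a \<in> {0, 1}"
  shows "x \<star> x = 0"
proof (cases "a = b")
  case False
  then show ?thesis using piece_mult_zero[OF p(1) p(1)] by simp
next
  case True
  obtain \<alpha> \<beta> \<gamma> where *: "x \<star> x = \<alpha> \<odot> f + \<beta> \<odot> x + \<gamma> \<odot> y" "(a, b) \<noteq> (1, 1) \<Longrightarrow> \<alpha> = 0"
    "(a, b) \<noteq> (c, d) \<Longrightarrow> \<gamma> = 0"
    by (rule eigen_comb[OF ind p piece_mult[OF p(1) p(1)]]) blast
  have nil: "x \<star> (x \<star> (x \<star> x)) = 0" using p by (simp add: piece_def)
  consider "a = 1" | "a = 0" using ab by auto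
  then show ?thesis
  proof cases
    case 1
    have "x \<noteq> t \<odot> f" for t using indep3D[OF ind, of t "-1" 0] by auto
    moreover have "x \<star> x = \<alpha> \<odot> f + \<beta> \<odot> x" using * ne by simp
    ultimately show ?thesis
      using 1 True p nil idem by (intro power4_zero_quadratic) (simp_all add: piece_def)
  next
    case 2
    then have "x \<star> x = \<beta> \<odot> x" using * ne by simp
    then show ?thesis by (rule nil_left_scalar[OF nil])
  qed
qed

lemma listed_pieces_11_11:
  assumes ind: "indep3 f x y" and p: "piece 1 1 x" "piece 1 1 y"
  shows listed
proof -
  have cx: "corner_nil x" "corner_nil y" using p by (simp_all add: piece_def)
  have cn: "corner_nil u" if "u \<in> span {x, y}" for u
    using that cx corner_nil_scale corner_nil_add unfolding span_pair_iff by metis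
  have closed: "u \<star> v \<in> span {x, y}" if uv: "u \<in> span {x, y}" "v \<in> span {x, y}" for u v
  proof -
    have c: "corner_nil (u \<star> v)" using corner_nil_mult cn uv by blast
    obtain a b c where w: "u \<star> v = a \<odot> f + b \<odot> x + c \<odot> y" by (rule indep3_span[OF ind])
    \<comment> \<open>Removing the nilpotent part from the nilpotent product leaves a multiple of
      \<open>f\<close> that is nilpotent again, so the coefficient \<open>a\<close> is zero.\<close>
    have "corner_nil ((- b) \<odot> x + (- c) \<odot> y)" by (intro cn) (unfold span_pair_iff, blast)
    then have "corner_nil (u \<star> v + ((- b) \<odot> x + (- c) \<odot> y))" by (rule corner_nil_add[OF c])
    moreover have "u \<star> v + ((- b) \<odot> x + (- c) \<odot> y) = a \<odot> f" by (simp add: w)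
    ultimately have "a = 0" using corner_nil_f by metis
    with w show ?thesis by (auto simp: span_pair_iff)
  qed
  show ?thesis
  proof (rule nil_plane[OF ind closed])
    show "u \<star> (u \<star> (u \<star> u)) = 0" if "u \<in> span {x, y}" for u using cn that by blast
  next
    assume "x \<star> x = 0" "x \<star> y = 0" "y \<star> x = 0" "y \<star> y = 0"
    then show listed using cx by (intro A09[OF ind]) (simp_all add: idem)
  next
    fix z assume z: "z \<in> span {x, y}" "indep3 f z (z \<star> z)" "z \<star> (z \<star> z) = 0"
    have "f \<star> z = z" "z \<star> f = z" using cn z(1) by blast+
    then show listed using assoc[of f z z]
      by (intro A10[OF z(2)]) (simp_all add: idem z assoc)
  qed
qed

lemma listed_pieces_00_00:
  assumes ind: "indep3 f x y" and p: "piece 0 0 x" "piece 0 0 y"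
  shows listed
proof -
  have fx: "f \<star> u = 0 \<and> u \<star> f = 0" if "u \<in> span {x, y}" for u
    using that p unfolding span_pair_iff piece_def by auto
  have closed: "u \<star> v \<in> span {x, y}" if uv: "u \<in> span {x, y}" "v \<in> span {x, y}" for u v
  proof -
    obtain a b c where w: "u \<star> v = a \<odot> f + b \<odot> x + c \<odot> y" by (rule indep3_span[OF ind])
    have "f \<star> (u \<star> v) = 0" using fx[OF uv(1)] by (simp add: assoc[symmetric])
    then have "a \<odot> f = 0" using p by (simp add: w idem piece_def)
    with w idem show ?thesis by (auto simp: span_pair_iff)
  qed
  show ?thesis
  proof (rule nil_plane[OF ind closed])
    show "u \<star> (u \<star> (u \<star> u)) = 0" if "u \<in> span {x, y}" for u using fx nilpotent_00 that by blast
  next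
    assume "x \<star> x = 0" "x \<star> y = 0" "y \<star> x = 0" "y \<star> y = 0"
    then show listed using p by (intro A03[OF ind]) (simp_all add: idem piece_def)
  next
    fix z assume z: "z \<in> span {x, y}" "indep3 f z (z \<star> z)" "z \<star> (z \<star> z) = 0"
    have "f \<star> z = 0" "z \<star> f = 0" using fx z(1) by blast+
    then show listed using assoc[of f z z]
      by (intro A11[OF z(2)]) (simp_all add: idem z assoc)
  qed
qed

text \<open>The six unordered pairs of distinct Peirce types, each in one fixed order; the other
  order is obtained by exchanging \<open>x\<close> and \<open>y\<close>. Mixed products are killed
  by their types, by nilpotency or by associativity.\<close>

lemma listed_pieces_distinct:
  assumes ind: "indep3 f x y" and p: "piece a b x" "piece c d y"
    and ord: "(a, b, c, d) \<in> {(1,1,1,0), (1,1,0,1), (1,1,0,0), (1,0,0,1), (1,0,0,0), (0,1,0,0)}"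
  shows listed
proof -
  interpret B: basis3 smul mul f x y by unfold_locales (rule ind)
  have ind': "indep3 f y x" by (rule B.indep3_coordsI) simp
  have ac: "a \<in> {0, 1}" "c \<in> {0, 1}" "(a, b) \<noteq> (c, d)"
    using ord by (elim insertE emptyE; simp)+
  have sq: "x \<star> x = 0" "y \<star> y = 0"
    using piece_square[OF ind p ac(3,1)] piece_square[OF ind' p(2,1) ac(3)[symmetric] ac(2)] by blast+
  have nil: "x \<star> (x \<star> (x \<star> x)) = 0" "y \<star> (y \<star> (y \<star> y)) = 0"
    by (simp_all add: sq)
  have zero: "b \<noteq> c \<Longrightarrow> x \<star> y = 0" "d \<noteq> a \<Longrightarrow> y \<star> x = 0"
    using piece_mult_zero[OF p] piece_mult_zero[OF p(2,1)] by blast+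
  obtain \<alpha> \<beta> \<gamma> where xy: "x \<star> y = \<alpha> \<odot> f + \<beta> \<odot> x + \<gamma> \<odot> y" "(a, d) \<noteq> (1, 1) \<Longrightarrow> \<alpha> = 0"
    "(a, d) \<noteq> (a, b) \<Longrightarrow> \<beta> = 0" "(a, d) \<noteq> (c, d) \<Longrightarrow> \<gamma> = 0"
    by (rule eigen_comb[OF ind p piece_mult[OF p]]) blast
  obtain \<alpha>' \<beta>' \<gamma>' where yx: "y \<star> x = \<alpha>' \<odot> f + \<beta>' \<odot> x + \<gamma>' \<odot> y" "(c, b) \<noteq> (1, 1) \<Longrightarrow> \<alpha>' = 0"
    "(c, b) \<noteq> (a, b) \<Longrightarrow> \<beta>' = 0" "(c, b) \<noteq> (c, d) \<Longrightarrow> \<gamma>' = 0"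
    by (rule eigen_comb[OF ind p piece_mult[OF p(2,1)]]) blast
  note P = p[unfolded piece_def]
  from ord consider "a = 1" "b = 1" "c = 1" "d = 0" | "a = 1" "b = 1" "c = 0" "d = 1"
    | "a = 1" "b = 1" "c = 0" "d = 0" | "a = 1" "b = 0" "c = 0" "d = 1"
    | "a = 1" "b = 0" "c = 0" "d = 0" | "a = 0" "b = 1" "c = 0" "d = 0" by auto
  then show ?thesis
  proof cases
    case 1
    then have "y \<star> x = 0" "x \<star> y = 0" using zero nil_left_scalar[OF nil(1), of y \<gamma>] xy by simp_all
    then show ?thesis using 1 P sq by (intro A15[OF ind']) (simp_all add: idem)
  next
    case 2
    then have "x \<star> y = 0" "y \<star> x = 0" using zero nil_right_scalar[OF nil(1), of y \<gamma>'] yx by simp_all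
    then show ?thesis using 2 P sq by (intro A16[OF ind']) (simp_all add: idem)
  next
    case 3
    then have "x \<star> y = 0" "y \<star> x = 0" using zero by simp_all
    then show ?thesis using 3 P sq by (intro A02[OF ind]) (simp_all add: idem)
  next
    case 4
    then have "y \<star> x = 0" using yx by simp
    moreover have "x \<star> y = \<alpha> \<odot> f" using xy 4 by simp
    \<comment> \<open>Types alone allow \<open>x y\<close> to be a multiple of \<open>f\<close>.
      Here the right side is zero while the left side is \<open>\<alpha>\<close> times
      \<open>x\<close>.\<close>
    moreover have "(x \<star> y) \<star> x = x \<star> (y \<star> x)" by (rule assoc)
    ultimately have "y \<star> x = 0" "x \<star> y = 0" using P 4 by auto
    then show ?thesis using 4 P sq by (intro A19[OF ind']) (simp_all add: idem)
  next
    case 5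
    then have "y \<star> x = 0" "x \<star> y = 0" using zero nil_right_scalar[OF nil(2), of x \<beta>] xy by simp_all
    then show ?thesis using 5 P sq by (intro A22[OF ind]) (simp_all add: idem)
  next
    case 6
    then have "x \<star> y = 0" "y \<star> x = 0" using zero nil_left_scalar[OF nil(2), of x \<beta>'] yx by simp_all
    then show ?thesis using 6 P sq by (intro A21[OF ind]) (simp_all add: idem)
  qed
qed

lemma listed_one_idempotent: listed
proof -
  have span_f: "v \<in> span {f} \<longleftrightarrow> (\<exists>a. v = a \<odot> f)" for v
    by (auto simp: span_singleton)
  obtain w where "\<forall>a b. w \<noteq> a \<odot> f + b \<odot> f" using outside_span2 by blast
  then have "w \<notin> span {f}" unfolding span_f by (metis add.right_neutral scale_zero_left)
  then obtain x a b where x: "x \<notin> span {f}" "a \<in> {0, 1}" "b \<in> {0, 1}" "piece a b x"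
    using piece_exists[of "span {f}" w] by (auto simp: span_base)
  obtain w' where "\<forall>a b. w' \<noteq> a \<odot> f + b \<odot> x" using outside_span2 by blast
  then have "w' \<notin> span {f, x}" unfolding span_pair_iff by blast
  then obtain y c d where y: "y \<notin> span {f, x}" "c \<in> {0, 1}" "d \<in> {0, 1}" "piece c d y"
    using piece_exists[of "span {f, x}" w'] by (auto simp: span_base)
  have ind: "indep3 f x y"
    using idem x(1) y(1) by (intro indep3I) (auto simp: span_f span_pair_iff)
  then interpret B: basis3 smul mul f x y by unfold_locales
  have ind': "indep3 f y x" by (rule B.indep3_coordsI) simp
  show ?thesis
  proof (cases "(a, b) = (c, d)")
    case True
    consider "a = 1" "b = 1" | "a = 0" "b = 0" | "a = 1" "b = 0" | "a = 0" "b = 1"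
      using x by auto
    then show ?thesis
    proof cases
      case 1
      then show ?thesis using listed_pieces_11_11[OF ind] x y True by simp
    next
      case 2
      then show ?thesis using listed_pieces_00_00[OF ind] x y True by simp
    next
      case 3
      then have "x \<star> x = 0" "x \<star> y = 0" "y \<star> x = 0" "y \<star> y = 0"
        using piece_mult_zero x(4) y(4) True by auto
      then show ?thesis using 3 x(4) y(4) True
        by (intro A17[OF ind]) (simp_all add: idem piece_def)
    next
      case 4
      then have "x \<star> x = 0" "x \<star> y = 0" "y \<star> x = 0" "y \<star> y = 0"
        using piece_mult_zero x(4) y(4) True by auto
      then show ?thesis using 4 x(4) y(4) True
        by (intro A18[OF ind]) (simp_all add: idem piece_def)
    qed
  next
    case False
    then have "(a, b, c, d) \<in> {(1,1,1,0), (1,1,0,1), (1,1,0,0), (1,0,0,1), (1,0,0,0), (0,1,0,0)}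
      \<or> (c, d, a, b) \<in> {(1,1,1,0), (1,1,0,1), (1,1,0,0), (1,0,0,1), (1,0,0,0), (0,1,0,0)}"
      using x(2,3) y(2,3) by (elim insertE emptyE) simp_all
    then show ?thesis
      by (rule disjE)
        (erule listed_pieces_distinct[OF ind x(4) y(4)], erule listed_pieces_distinct[OF ind' y(4) x(4)])
  qed
qed

end

section \<open>Nil associative algebras and the associative case\<close>

context assoc3
begin

lemma listed_square_zero:
  assumes sq: "\<And>z. z \<star> z = 0" and xy: "x \<star> y \<noteq> 0"
  shows listed
proof -
  have "y \<star> x + x \<star> y = (x + y) \<star> (x + y)" by (simp add: sq[of x] sq[of y])
  also have "\<dots> = 0" by (rule sq)
  finally have yx: "y \<star> x = - (x \<star> y)" by (simp only: eq_neg_iff_add_eq_0)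
  have p1: "x \<star> (x \<star> y) = 0" by (simp add: assoc[symmetric] sq)
  have p2: "x \<star> y \<star> y = 0" by (simp add: assoc sq)
  have p3: "y \<star> (x \<star> y) = 0" by (simp add: assoc[symmetric] yx p2)
  have p4: "x \<star> y \<star> x = 0" by (simp add: assoc yx p1)
  note p = p1 p2 p3 p4
  have "indep3 x y (x \<star> y)"
  proof (rule indep3I)
    show "x \<noteq> 0" "y \<noteq> a \<odot> x" for a using xy sq by auto
    show "x \<star> y \<noteq> a \<odot> x + b \<odot> y" for a b
    proof
      assume eq: "x \<star> y = a \<odot> x + b \<odot> y"
      have "b \<odot> (x \<star> y) = x \<star> (a \<odot> x + b \<odot> y)" "a \<odot> (x \<star> y) = (a \<odot> x + b \<odot> y) \<star> y"
        by (simp_all add: sq)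
      with eq p have "b \<odot> (x \<star> y) = 0" "a \<odot> (x \<star> y) = 0" by simp_all
      with xy have "a = 0" "b = 0" by simp_all
      with eq xy show False by simp
    qed
  qed
  then show ?thesis by (rule A12) (simp_all add: sq p yx)
qed

text \<open>All products turn out to be multiples of \<open>z = x x\<close>, which annihilates
  everything. The algebra is thus a bilinear form on a plane, and vectors of square zero bring the
  form to normal form: two independent ones, or a single one beside \<open>x\<close> if the roots
  coincide.\<close>

lemma listed_cube_zero:
  assumes nil: "\<And>z. z \<star> (z \<star> z) = 0" and xx: "x \<star> x \<noteq> 0"
  shows listed
proof -
  define z where "z = x \<star> x"
  have xz: "x \<star> z = 0" "z \<star> x = 0" using nil by (simp_all add: z_def assoc)
  have zz: "z \<star> z = 0" by (subst (1) z_def) (simp add: assoc xz)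
  obtain y0 where y0: "\<And>a b. y0 \<noteq> a \<odot> x + b \<odot> z" using outside_span2 by blast
  have "z \<noteq> a \<odot> x" for a
    using xx xz by (auto simp: z_def)
  then have ind0: "indep3 x z y0"
    using y0 xx by (intro indep3I) (auto simp: z_def)
  then interpret B: basis3 smul mul x z y0 by unfold_locales
  obtain a b c where xy: "x \<star> y0 = a \<odot> x + b \<odot> z + c \<odot> y0" by (rule indep3_span[OF ind0])
  \<comment> \<open>The third power of left multiplication by \<open>x\<close> is zero, and
    \<open>c\<close> is its eigenvalue modulo the span of \<open>x\<close> and
    \<open>z\<close>.\<close>
  have "x \<star> (x \<star> (x \<star> y0)) = 0" using nil[of x] by (metis assoc mul_simps(7))
  then have "B.c3 (x \<star> (x \<star> (x \<star> y0))) = 0" by simp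
  then have "c = 0" by (simp add: xy xz z_def[symmetric])
  \<comment> \<open>Likewise for right multiplication by \<open>y0\<close>, which has eigenvalue
    \<open>a\<close> on \<open>x\<close> modulo \<open>z\<close>.\<close>
  have "((x \<star> y0) \<star> y0) \<star> y0 = 0" using nil[of y0] by (simp add: assoc)
  moreover have "z \<star> y0 = a \<odot> z" by (simp add: z_def assoc xy \<open>c = 0\<close> xz[unfolded z_def])
  ultimately have "B.c1 (((x \<star> y0) \<star> y0) \<star> y0) = 0" "z \<star> y0 = a \<odot> z" by simp_all
  then have "a = 0" by (simp add: xy \<open>c = 0\<close>)
  have xy0: "x \<star> y0 = b \<odot> z" using xy \<open>a = 0\<close> \<open>c = 0\<close> by simp
  obtain a' b' c' where yx: "y0 \<star> x = a' \<odot> x + b' \<odot> z + c' \<odot> y0" by (rule indep3_span[OF ind0])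
  have "((y0 \<star> x) \<star> x) \<star> x = 0" using nil[of x] by (simp add: assoc)
  then have "B.c3 (((y0 \<star> x) \<star> x) \<star> x) = 0" by simp
  then have "c' = 0" by (simp add: yx xz z_def[symmetric])
  have "y0 \<star> (y0 \<star> (y0 \<star> x)) = 0" using nil[of y0] by (metis assoc mul_simps(7))
  moreover have "y0 \<star> z = a' \<odot> z"
    by (simp add: z_def assoc[symmetric] yx \<open>c' = 0\<close> xz[unfolded z_def])
  ultimately have "B.c1 (y0 \<star> (y0 \<star> (y0 \<star> x))) = 0" "y0 \<star> z = a' \<odot> z" by simp_all
  then have "a' = 0" by (simp add: yx \<open>c' = 0\<close>)
  have yx0: "y0 \<star> x = b' \<odot> z" using yx \<open>a' = 0\<close> \<open>c' = 0\<close> by simp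
  \<comment> \<open>The shift makes \<open>x y\<close> vanish, so that \<open>k\<close> alone
    measures the asymmetry of the form.\<close>
  define y where "y = y0 - b \<odot> x"
  define k where "k = b' - b"
  have xy: "x \<star> y = 0" "y \<star> x = k \<odot> z"
    by (simp_all add: y_def k_def xy0 yx0 z_def[symmetric] scale_distribs)
  have zy: "z \<star> y = 0" by (simp add: z_def assoc xy)
  have yz: "y \<star> z = 0" by (simp add: z_def assoc[symmetric] xy xz[unfolded z_def])
  have ind: "indep3 x z y" by (rule B.indep3_coordsI) (simp add: y_def)
  then interpret B': basis3 smul mul x z y by unfold_locales
  obtain p q r where yy: "y \<star> y = p \<odot> x + q \<odot> z + r \<odot> y" by (rule indep3_span[OF ind])
  have "x \<star> (y \<star> y) = 0" by (simp add: assoc[symmetric] xy)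
  then have "p \<odot> z = 0" by (simp add: yy xy xz z_def[symmetric])
  then have "p = 0" using xx z_def by auto
  have "y \<star> (y \<star> y) = 0" by (rule nil)
  then have "r * r = 0" using arg_cong[of "y \<star> (y \<star> y)" 0 B'.c3] by (simp add: yy \<open>p = 0\<close> yz)
  then have yy: "y \<star> y = q \<odot> z" using yy \<open>p = 0\<close> by simp
  note mult = z_def[symmetric] xy yy xz zz yz zy
  \<comment> \<open>The square of \<open>r \<odot> x + y\<close> is \<open>(r\<^sup>2 + k * r + q) \<odot> z\<close>; its roots \<open>r1\<close>, \<open>r2\<close> give the vectors of square zero.\<close>
  define d where "d = csqrt (k\<^sup>2 - 4 * q)"
  have d: "d * d = k * k - 4 * q" by (simp add: d_def power2_eq_square[symmetric])
  define r1 r2 where "r1 = (d - k) / 2" and "r2 = (- d - k) / 2"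
  have k: "k = - r1 - r2" by (simp add: r1_def r2_def field_simps)
  have q: "q = r1 * r2" using d by (simp add: r1_def r2_def field_simps)
  define u1 u2 where "u1 = r1 \<odot> x + y" and "u2 = r2 \<odot> x + y"
  show ?thesis
  proof (cases "r1 = r2")
    case True
    have uz: "u1 \<star> z = 0" "z \<star> u1 = 0" by (simp_all add: u1_def mult)
    have ux: "u1 \<star> x = (- r1) \<odot> z" "x \<star> u1 = r1 \<odot> z" "u1 \<star> u1 = 0"
      unfolding B'.vec_eq by (simp_all add: u1_def mult k q True)
    show ?thesis
    proof (cases "r1 = 0")
      case r0: True
      have "indep3 x z u1" by (rule B'.indep3_coordsI) (simp add: u1_def)
      then show ?thesis by (rule A04) (simp_all add: mult ux uz r0)
    next
      case False
      have "indep3 x z ((1 / r1) \<odot> u1)"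
        by (rule B'.indep3_coordsI) (use False in \<open>simp add: u1_def\<close>)
      then show ?thesis by (rule A13) (use False in \<open>simp_all add: mult ux uz\<close>)
    qed
  next
    case False
    \<comment> \<open>\<open>s\<close> and \<open>\<alpha> * s\<close> are half the sum and half the
      difference of the coefficients of \<open>z\<close> in \<open>u1 u2\<close> and
      \<open>u2 u1\<close>. So \<open>\<alpha> = 0\<close> means that the form is symmetric.\<close>
    define s where "s = - (r1 - r2) * (r1 - r2) / 2"
    define \<alpha> where "\<alpha> = - (r1 + r2) / (r1 - r2)"
    have "s \<noteq> 0" using False by (simp add: s_def)
    have ind': "indep3 u1 u2 (s \<odot> z)"
      by (rule B'.indep3_coordsI) (use False \<open>s \<noteq> 0\<close> in \<open>auto simp: u1_def u2_def eq_neg_iff_add_eq_0[symmetric]\<close>)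
    have uz: "u1 \<star> z = 0" "z \<star> u1 = 0" "u2 \<star> z = 0" "z \<star> u2 = 0" by (simp_all add: u1_def u2_def mult)
    have us: "u1 \<star> u1 = 0" "u2 \<star> u2 = 0"
      unfolding B'.vec_eq by (simp_all add: u1_def u2_def mult k q algebra_simps)
    have "\<alpha> * s = (r1 + r2) * (r1 - r2) / 2"
      using False by (simp add: \<alpha>_def s_def) (simp add: algebra_simps)
    then have \<alpha>s: "(1 + \<alpha>) * s = r2 * (r1 - r2)" "(1 - \<alpha>) * s = r1 * (r2 - r1)"
      by (simp_all add: distrib_right left_diff_distrib) (simp_all add: s_def field_simps)
    have up: "u1 \<star> u2 = (1 + \<alpha>) \<odot> s \<odot> z" "u2 \<star> u1 = (1 - \<alpha>) \<odot> s \<odot> z"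
      unfolding scale_scale \<alpha>s B'.vec_eq by (simp_all add: u1_def u2_def mult k q algebra_simps)
    show ?thesis
    proof (cases "\<alpha> = 0")
      case True
      then show ?thesis by (intro A05[OF ind']) (simp_all add: us up uz zz)
    next
      case False
      show ?thesis by (rule A14[OF ind' False]) (simp_all add: us up uz zz)
    qed
  qed
qed

text \<open>The nilpotency index separates the cases: an element with nonzero cube generates the
  algebra. If all squares vanish, the hypothesis on \<open>x y\<close> excludes the zero
  product.\<close>

lemma listed_nil:
  assumes nil: "\<And>z. z \<star> (z \<star> (z \<star> z)) = 0" and xy: "x \<star> y \<noteq> 0"
  shows listed
proof (cases "\<forall>z. z \<star> (z \<star> z) = 0")
  case True
  show ?thesis
  proof (cases "\<forall>z. z \<star> z = 0")
    case True
    then show ?thesis using listed_square_zero xy by blast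
  next
    case False
    then show ?thesis using listed_cube_zero True by blast
  qed
next
  case False
  then obtain z where z: "z \<star> (z \<star> z) \<noteq> 0" by blast
  have z5: "z \<star> (z \<star> (z \<star> (z \<star> z))) = 0" by (simp add: nil)
  have "indep3 z (z \<star> z) (z \<star> (z \<star> z))"
    unfolding indep3_def
  proof (intro allI impI)
    fix a b c assume eq: "a \<odot> z + b \<odot> (z \<star> z) + c \<odot> (z \<star> (z \<star> z)) = 0"
    have "z \<star> (z \<star> (a \<odot> z + b \<odot> (z \<star> z) + c \<odot> (z \<star> (z \<star> z)))) = 0"
      "z \<star> (a \<odot> z + b \<odot> (z \<star> z) + c \<odot> (z \<star> (z \<star> z))) = 0" unfolding eq by simp_all
    then have "a = 0" "b = 0" using z by (simp_all add: nil)
    with eq z show "a = 0 \<and> b = 0 \<and> c = 0" by simp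
  qed
  then show ?thesis by (rule A06) (simp_all add: assoc nil)
qed

lemma listed_associative:
  assumes xy: "x \<star> y \<noteq> 0"
  shows listed
proof (cases "\<exists>f. f \<star> f = f \<and> f \<noteq> 0")
  case True
  then obtain f where f: "f \<star> f = f" "f \<noteq> 0" by blast
  show ?thesis
  proof (rule ccontr)
    assume not: "\<not> listed"
    have "one_idempotent smul mul f"
    proof unfold_locales
      fix g assume g: "g \<star> g = g"
      show "g = 0" if "f \<star> g = 0" "g \<star> f = 0"
        using listed_orthogonal_idempotents[OF f g] that not by blast
      show "g = 0 \<or> g = f" if "f \<star> g = g" "g \<star> f = g"
        using listed_orthogonal_idempotents[OF g, of "f - g"] that not f g by auto
    qed (use f in auto)
    then have listed by (rule one_idempotent.listed_one_idempotent)
    with not show False by contradiction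
  qed
next
  case False
  have "z \<star> (z \<star> (z \<star> z)) = 0" for z
    by (rule nilpotent_or_idempotent[of z]) (use False in blast)+
  then show ?thesis using xy by (rule listed_nil)
qed

end

section \<open>The nucleus of an assosymmetric algebra\<close>

locale assosym3 = algebra3 smul mul
  for smul :: "complex \<Rightarrow> 'a::ab_group_add \<Rightarrow> 'a" (infixr "\<odot>" 80)
    and mul :: "'a \<Rightarrow> 'a \<Rightarrow> 'a" (infixl "\<star>" 75) +
  assumes assosymmetric: "assosymmetric mul"
begin

abbreviation ass :: "'a \<Rightarrow> 'a \<Rightarrow> 'a \<Rightarrow> 'a" where
  "ass \<equiv> associator mul"

abbreviation com :: "'a \<Rightarrow> 'a \<Rightarrow> 'a" where
  "com x y \<equiv> x \<star> y - y \<star> x"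

lemmas ass_def = associator_def[of mul]

lemma ass_perm: "ass x y z = ass y x z" "ass x y z = ass x z y"
  using assosymmetric unfolding assosymmetric_def by blast+

lemma ass_comm: "ass x y z = ass y x z" "ass x y z = ass x z y" "ass x y z = ass z y x"
    "ass x y z = ass y z x" "ass x y z = ass z x y"
  using ass_perm by metis+

lemma ass_simps [simp]:
  "ass (x + x') y z = ass x y z + ass x' y z" "ass x (y + y') z = ass x y z + ass x y' z"
  "ass x y (z + z') = ass x y z + ass x y z'"
  "ass (x - x') y z = ass x y z - ass x' y z" "ass x (y - y') z = ass x y z - ass x y' z"
  "ass x y (z - z') = ass x y z - ass x y z'"
  "ass (c \<odot> x) y z = c \<odot> ass x y z" "ass x (c \<odot> y) z = c \<odot> ass x y z" "ass x y (c \<odot> z) = c \<odot> ass x y z"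
  "ass (- x) y z = - ass x y z" "ass x (- y) z = - ass x y z" "ass x y (- z) = - ass x y z"
  "ass 0 y z = 0" "ass x 0 z = 0" "ass x y 0 = 0"
  by (simp_all add: ass_def scale_distribs)

lemma double_zero: "(x :: 'a) + x = 0 \<Longrightarrow> x = 0"
  using scale_eq_0_iff[of 2 x] scale_left_distrib[of 1 1 x] by simp

lemma teichmueller:
  "ass (w \<star> x) y z - ass w (x \<star> y) z + ass w x (y \<star> z) = w \<star> ass x y z + ass w x y \<star> z"
  by (simp add: ass_def)

lemma ass_mult: "ass (w \<star> x) y z = x \<star> ass w y z + ass x y z \<star> w"
proof -
  define D where "D w x y z = ass (w \<star> x) y z - x \<star> ass w y z - ass x y z \<star> w" for w x y z
  \<comment> \<open>Two cyclic shifts of the Teichmueller identity add up to this; as \<open>D\<close> is symmetric in the other two arguments, three such steps give \<open>D = - D\<close>.\<close>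
  have S: "D w x y z + D z w x y = 0" for w x y z
  proof -
    have "D w x y z + D z w x y =
       (ass (w \<star> x) y z - ass w (x \<star> y) z + ass w x (y \<star> z) - w \<star> ass x y z - ass w x y \<star> z)
     + (ass (x \<star> y) z w - ass x (y \<star> z) w + ass x y (z \<star> w) - x \<star> ass y z w - ass x y z \<star> w)"
      using ass_comm(1)[of "x \<star> y" w z] ass_comm(2)[of "x \<star> y" w z]
        ass_comm[of w x "y \<star> z"] ass_comm[of x y "z \<star> w"] ass_comm[of w y z]
        ass_comm[of w x y] ass_comm[of x y z]
      unfolding D_def by (simp add: algebra_simps)
    also have "\<dots> = 0"
      unfolding teichmueller by simp
    finally show ?thesis .
  qed
  have sym: "D w x y z = D w x z y" for w x y z
    unfolding D_def using ass_perm(2) by metis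
  have "D w x y z = - D z w y x" using S[of w x y z] sym by (metis eq_neg_iff_add_eq_0)
  moreover have "D z w y x = - D x z w y" using S[of z w y x] by (metis eq_neg_iff_add_eq_0)
  moreover have "D x z y w = - D w x z y" using S[of x z y w] by (metis eq_neg_iff_add_eq_0)
  ultimately have "D w x y z + D w x y z = 0" using sym by (metis add.inverse_inverse add_eq_0_iff)
  then have "D w x y z = 0" by (rule double_zero)
  then show ?thesis by (simp add: D_def algebra_simps)
qed

text \<open>Eliminating products from the Teichmueller identity by \<open>ass_mult\<close> gives
  \<open>E\<close>. Exchanging \<open>x\<close> and \<open>y\<close> in \<open>E\<close> preserves
  its last two terms, so the difference is twice the identity \<open>eq\<close>. Hence
  \<open>com x (ass w y z)\<close> is symmetric in all four arguments.\<close>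

lemma com_ass: "com x (ass w y z) = com w (ass x y z)"
proof -
  have E: "com x (ass w y z) - com y (ass w x z) + com z (ass w x y) - com w (ass x y z) = 0" for w x y z
  proof -
    have "ass (w \<star> x) y z - ass (x \<star> y) w z + ass (y \<star> z) w x = w \<star> ass x y z + ass w x y \<star> z"
      using teichmueller[of w x y z] ass_comm by metis
    moreover have "ass (w \<star> x) y z = x \<star> ass w y z + ass x y z \<star> w"
      "ass (x \<star> y) w z = y \<star> ass w x z + ass w y z \<star> x"
      "ass (y \<star> z) w x = z \<star> ass w x y + ass w x z \<star> y"
      using ass_mult ass_comm by metis+
    ultimately show ?thesis by (simp add: algebra_simps)
  qed
  have eq: "com x (ass w y z) = com y (ass w x z)" for w x y z
  proof -
    have "(com x (ass w y z) - com y (ass w x z)) + (com x (ass w y z) - com y (ass w x z)) =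
       (com x (ass w y z) - com y (ass w x z) + com z (ass w x y) - com w (ass x y z)) -
       (com y (ass w x z) - com x (ass w y z) + com z (ass w y x) - com w (ass y x z))"
      by (simp add: ass_perm(1)[of y x z] ass_perm(2)[of w y x])
    also have "\<dots> = 0" unfolding E by simp
    finally have "com x (ass w y z) - com y (ass w x z) = 0" by (rule double_zero)
    then show ?thesis by (simp only: right_minus_eq)
  qed
  then show ?thesis using ass_comm by metis
qed

text \<open>By \<open>ass_mult\<close> this associator is the difference of the two sides of
  \<open>com_ass\<close>.\<close>

lemma ass_com: "ass (com w x) y z = 0"
  using com_ass[of x w y z] by (simp add: ass_mult algebra_simps)

lemma ass_mult_comm: "ass (w \<star> x) y z = ass (x \<star> w) y z"
  using ass_com[of w x y z] by simp

text \<open>Testing the first slot suffices: the associator is symmetric, so this is membership in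
  the full nucleus.\<close>

definition nuclear :: "'a \<Rightarrow> bool" where
  "nuclear n \<longleftrightarrow> (\<forall>y z. ass n y z = 0)"

lemma nuclear_ass:
  assumes "nuclear n"
  shows "ass n y z = 0" "ass y n z = 0" "ass y z n = 0"
  using assms ass_comm unfolding nuclear_def by metis+

lemma nuclear_assoc:
  assumes "nuclear x \<or> nuclear y \<or> nuclear z"
  shows "(x \<star> y) \<star> z = x \<star> (y \<star> z)"
proof -
  have "ass x y z = 0" using assms nuclear_ass by blast
  then show ?thesis by (simp add: ass_def)
qed

lemma nuclear_lin:
  "nuclear x \<Longrightarrow> nuclear y \<Longrightarrow> nuclear (x + y)" "nuclear x \<Longrightarrow> nuclear y \<Longrightarrow> nuclear (x - y)"
  "nuclear x \<Longrightarrow> nuclear (c \<odot> x)" "nuclear (com u w)"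
  using ass_com unfolding nuclear_def by simp_all

lemma ass_square: "ass x x x = com (x \<star> x) x"
  by (simp add: ass_def)

lemma nuclear_cube: "nuclear (ass x x x)"
  unfolding ass_square by (rule nuclear_lin)

text \<open>Stated for an abstract symmetric map because it serves both for \<open>ass\<close> and
  for \<open>ass (ass x y z) p q\<close> with \<open>p\<close> and \<open>q\<close> fixed. The
  diagonal values at \<open>x + y\<close> and \<open>x - y\<close> add up to
  \<open>6 F x y y\<close>.\<close>

lemma polarization:
  fixes F :: "'a \<Rightarrow> 'a \<Rightarrow> 'a \<Rightarrow> 'a"
  assumes perm: "\<And>x y z. F x y z = F y x z" "\<And>x y z. F x y z = F x z y"
    and add: "\<And>x x' y z. F (x + x') y z = F x y z + F x' y z"
      "\<And>x x' y z. F (x - x') y z = F x y z - F x' y z"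
    and diag: "\<And>x. F x x x = 0"
  shows "F x y z = 0"
proof -
  have add': "F x (y + y') z = F x y z + F x y' z" "F x y (z + z') = F x y z + F x y z'"
    "F x (y - y') z = F x y z - F x y' z" "F x y (z - z') = F x y z - F x y z'" for x y y' z z'
    using add perm by metis+
  have F2: "F x y y = 0" for x y
  proof -
    have p: "F x y x = F x x y" "F y x x = F x x y" "F y x y = F x y y" "F y y x = F x y y"
      using perm by metis+
    have "F (x + y) (x + y) (x + y) = 0" "F (x - y) (x - y) (x - y) = 0" by (rule diag)+
    then have 1: "F x x y + F x x y + F x x y + (F x y y + F x y y + F x y y) = 0"
      and 2: "F x y y + F x y y + F x y y = F x x y + F x x y + F x x y"
      by (simp_all add: add add' p diag[of x] diag[of y] algebra_simps)
    have "(F x y y + F x y y + F x y y) + (F x y y + F x y y + F x y y) = 0"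
      using 1 unfolding 2 .
    then have "F x y y + F x y y + F x y y = 0" by (rule double_zero)
    moreover have "F x y y + F x y y + F x y y = 3 \<odot> F x y y"
      using scale_left_distrib[of 1 1 "F x y y"] scale_left_distrib[of 2 1 "F x y y"] by simp
    ultimately show ?thesis by simp
  qed
  have "F x (y + z) (y + z) = 0" by (rule F2)
  then have "F x y z + F x y z = 0"
    using perm(2)[of x z y] by (simp add: add' F2[of x y] F2[of x z])
  then show ?thesis by (rule double_zero)
qed

lemma ass_zeroI:
  assumes "\<And>e. ass e e e = 0"
  shows "ass x y z = 0"
  by (rule polarization[of ass, OF ass_perm]) (simp_all only: ass_simps assms)

lemma nuclear_ass_value: "nuclear (ass x y z)"
proof -
  have "ass (ass x y z) p q = 0" for p q
  proof (rule polarization[of "\<lambda>x y z. ass (ass x y z) p q"])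
    show "ass (ass x y z) p q = ass (ass y x z) p q" "ass (ass x y z) p q = ass (ass x z y) p q" for x y z
      using ass_perm[of x y z] by simp_all
    show "ass (ass x x x) p q = 0" for x
      using nuclear_cube unfolding nuclear_def by blast
  qed (simp_all only: ass_simps)
  then show ?thesis by (simp add: nuclear_def)
qed

end

text \<open>From here on \<open>e\<close> is an element of the algebra and hides the basis vectors
  \<open>e i\<close> of the tables.\<close>

locale nonassociative3 = assosym3 smul mul
  for smul :: "complex \<Rightarrow> 'a::ab_group_add \<Rightarrow> 'a" (infixr "\<odot>" 80)
    and mul :: "'a \<Rightarrow> 'a \<Rightarrow> 'a" (infixl "\<star>" 75) +
  fixes e v
  assumes v: "v = ass e e e" "v \<noteq> 0"
begin

section \<open>Excluding a nucleus of dimension one\<close>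

lemma nuclear_v: "nuclear v"
  unfolding v(1) by (rule nuclear_cube)

lemma nuclear_independent: "nuclear n \<Longrightarrow> e \<noteq> n"
  using v nuclear_ass by force

text \<open>If the nucleus were the line of \<open>v\<close>, all associators would be multiples of
  \<open>v\<close>, and the algebra would act on this line by the same linear form from both sides.
  If the form is zero, \<open>ass_mult\<close> makes all products nuclear, and
  \<open>ass e e e = 0\<close>. Otherwise some \<open>u\<close> fixes \<open>v\<close>; then
  \<open>u u - 2 u\<close> is nuclear, hence a multiple of \<open>v\<close>, and kills
  \<open>v\<close>, although it sends \<open>v\<close> to \<open>- v\<close>.\<close>

lemma nucleus_not_line: "\<exists>n. nuclear n \<and> (\<forall>c. n \<noteq> c \<odot> v)"
proof (rule ccontr)
  assume "\<nexists>n. nuclear n \<and> (\<forall>c. n \<noteq> c \<odot> v)"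
  then have line: "\<exists>c. n = c \<odot> v" if "nuclear n" for n using that by blast
  obtain w0 where w0: "\<And>a b. w0 \<noteq> a \<odot> v + b \<odot> e" using outside_span2 by blast
  obtain k where k: "ass w0 e e = k \<odot> v" using line nuclear_ass_value by blast
  \<comment> \<open>The shift cancels the associator of \<open>w0\<close> with \<open>e\<close> and
    \<open>e\<close>.\<close>
  define w where "w = w0 - k \<odot> e"
  have wee: "ass w e e = 0" "ass e e w = 0" "ass e w e = 0"
    using ass_comm(4)[of w e e] ass_perm(2)[of e w e] by (simp_all add: w_def k v(1)[symmetric])
  have w: "w \<noteq> a \<odot> v + b \<odot> e" for a b
  proof
    assume "w = a \<odot> v + b \<odot> e"
    then have "w0 = a \<odot> v + (b + k) \<odot> e" by (simp add: w_def algebra_simps scale_distribs)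
    with w0 show False by blast
  qed
  have ind: "indep3 v e w"
    using w nuclear_independent[OF nuclear_lin(3)[OF nuclear_v]] v(2) by (intro indep3I) auto
  have wv: "w \<star> v = v \<star> w" using com_ass[of w e e e] by (simp add: wee v(1))
  obtain kw where kw: "w \<star> v = kw \<odot> v"
  proof -
    have "ass (e \<star> w) e e = w \<star> v" using ass_mult[of e w e e] by (simp add: wee v(1))
    then show thesis using that line nuclear_ass_value by metis
  qed
  have ev: "e \<star> v = v \<star> e"
  proof -
    \<comment> \<open>Both \<open>ass w w e\<close> and \<open>ass w w w\<close> are multiples of
      \<open>v\<close> that commute with \<open>e\<close>. Were both zero, \<open>w\<close> would be
      a nuclear element off the line of \<open>v\<close>.\<close>
    have *: "com e (ass w w e) = 0" using com_ass[of e w w e] by (simp add: ass_comm(4)[of e w e] wee)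
    obtain k1 where k1: "ass w w e = k1 \<odot> v" using line nuclear_ass_value by blast
    obtain k2 where k2: "ass w w w = k2 \<odot> v" using line nuclear_ass_value by blast
    have "com e (ass w w w) = com w (ass e w w)" by (rule com_ass)
    moreover have "ass e w w = k1 \<odot> v" using k1 ass_comm by metis
    ultimately have **: "k2 \<odot> com e v = 0" by (simp add: k2 wv scale_distribs)
    have "k1 \<odot> com e v = 0" using * by (simp add: k1 scale_distribs)
    moreover have "\<not> (k1 = 0 \<and> k2 = 0)"
    proof
      assume "k1 = 0 \<and> k2 = 0"
      then have z: "ass w w e = 0" "ass w w w = 0" "ass w e w = 0"
        using k1 k2 ass_perm(2)[of w e w] by simp_all
      have "nuclear w"
        unfolding nuclear_def
      proof (intro allI)
        fix y y'
        obtain a b c where y: "y = a \<odot> v + b \<odot> e + c \<odot> w" by (rule indep3_span[OF ind])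
        obtain a' b' c' where y': "y' = a' \<odot> v + b' \<odot> e + c' \<odot> w" by (rule indep3_span[OF ind])
        show "ass w y y' = 0" by (simp add: y y' nuclear_ass[OF nuclear_v] z wee)
      qed
      then show False using line w[of _ 0] by force
    qed
    ultimately show ?thesis using ** by auto
  qed
  obtain ke where ke: "e \<star> v = ke \<odot> v"
  proof -
    have "ass (e \<star> e) e e = 2 \<odot> (e \<star> v)"
      using ass_mult[of e e e e] scale_left_distrib[of 1 1 "e \<star> v"] by (simp add: ev v(1)[symmetric])
    then obtain c where "2 \<odot> (e \<star> v) = c \<odot> v" using line nuclear_ass_value by metis
    then have "(1 / 2) \<odot> 2 \<odot> (e \<star> v) = (1 / 2) \<odot> c \<odot> v" by simp
    then show thesis by (intro that[of "c / 2"]) simp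
  qed
  have vv: "v \<star> v = 0"
  proof -
    have ee: "(e \<star> e) \<star> v = (ke * ke) \<odot> v"
      using nuclear_assoc[of e e v] nuclear_v by (simp add: ke)
    \<comment> \<open>\<open>v\<close> is the commutator of \<open>e e\<close> and \<open>e\<close>,
      which both act on \<open>v\<close> by scalars; so it acts on itself by zero.\<close>
    have "v \<star> v = com (e \<star> e) e \<star> v"
      using v(1) ass_square by simp
    also have "\<dots> = (e \<star> e) \<star> (e \<star> v) - e \<star> ((e \<star> e) \<star> v)"
      using nuclear_assoc[of "e \<star> e" e v] nuclear_assoc[of e "e \<star> e" v] nuclear_v by simp
    also have "\<dots> = 0" by (simp add: ke ee)
    finally show ?thesis .
  qed
  have scal: "\<exists>l. x \<star> v = l \<odot> v \<and> v \<star> x = l \<odot> v" for x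
  proof -
    obtain a b c where x: "x = a \<odot> v + b \<odot> e + c \<odot> w" by (rule indep3_span[OF ind])
    show ?thesis
      by (rule exI[of _ "b * ke + c * kw"]) (simp add: x vv ke kw ev[symmetric] wv[symmetric] scale_distribs)
  qed
  show False
  proof (cases "\<forall>x. x \<star> v = 0")
    case True
    then have zero: "x \<star> v = 0" "v \<star> x = 0" for x using scal[of x] by auto
    have "x \<star> (c \<odot> v) = 0" "(c \<odot> v) \<star> x = 0" for x c by (simp_all add: zero)
    then have "x \<star> ass p q r = 0" "ass p q r \<star> x = 0" for x p q r
      using line[OF nuclear_ass_value] by metis+
    then have "nuclear (w \<star> x)" for w x unfolding nuclear_def by (simp add: ass_mult)
    then have "\<exists>c. e \<star> e = c \<odot> v" using line by blast
    then have "ass e e e = 0" unfolding ass_square using zero by auto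
    with v show False by simp
  next
    case False
    then obtain u0 l where u0: "u0 \<star> v = l \<odot> v" "v \<star> u0 = l \<odot> v" "l \<noteq> 0" using scal by (metis scale_zero_left)
    define u where "u = (1 / l) \<odot> u0"
    have u: "u \<star> v = v" "v \<star> u = v" using u0 by (simp_all add: u_def)
    have "u \<star> ass p q r = ass p q r" "ass p q r \<star> u = ass p q r" for p q r
      using line[OF nuclear_ass_value[of p q r]] u by auto
    then have "nuclear (u \<star> u - (u + u))" unfolding nuclear_def by (simp add: ass_mult)
    then obtain c where c: "u \<star> u - (u + u) = c \<odot> v" using line by blast
    have "(u \<star> u - (u + u)) \<star> v = - v" by (simp add: nuclear_assoc nuclear_v u)
    then show False unfolding c using v(2) vv by simp
  qed
qed

end

section \<open>Nonassociative algebras\<close>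

locale frame3 = assosym3 smul mul + basis3 smul mul v n e
  for smul :: "complex \<Rightarrow> 'a::ab_group_add \<Rightarrow> 'a" (infixr "\<odot>" 80)
    and mul :: "'a \<Rightarrow> 'a \<Rightarrow> 'a" (infixl "\<star>" 75)
    and v n e +
  assumes nuclear: "nuclear v" "nuclear n" and ass_e: "ass e e e = v"
begin

lemma v_nonzero: "v \<noteq> 0"
  using indep3D[OF indep, of 1 0 0] by auto

text \<open>Consequently the kernel of \<open>c3\<close> is the nucleus.\<close>

lemma ass_eq: "ass x y z = (c3 x * c3 y * c3 z) \<odot> v"
proof -
  note n = nuclear_ass[OF nuclear(1)] nuclear_ass[OF nuclear(2)]
  have "ass (c1 x \<odot> v + c2 x \<odot> n + c3 x \<odot> e) (c1 y \<odot> v + c2 y \<odot> n + c3 y \<odot> e)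
      (c1 z \<odot> v + c2 z \<odot> n + c3 z \<odot> e) = (c3 x * c3 y * c3 z) \<odot> v"
    by (simp add: n ass_e mult_ac)
  then show ?thesis by (simp only: expand[symmetric])
qed

lemma assoc: "c3 x = 0 \<or> c3 y = 0 \<or> c3 z = 0 \<Longrightarrow> (x \<star> y) \<star> z = x \<star> (y \<star> z)"
  using ass_eq[of x y z] by (auto simp: ass_def)

lemma c3_comm: "c3 (x \<star> y) = c3 (y \<star> x)"
  using ass_mult_comm[of x y e e] v_nonzero by (simp add: ass_eq)

text \<open>This is \<open>ass_mult\<close> with \<open>e\<close> in both remaining slots, and the
  main source of equations for the action on \<open>v\<close>.\<close>

lemma c3_mult: "c3 (x \<star> y) \<odot> v = c3 x \<odot> (y \<star> v) + c3 y \<odot> (v \<star> x)"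
  using ass_mult[of x y e e] by (simp add: ass_eq)

lemma c3_mult_zero: "c3 x = 0 \<Longrightarrow> c3 y = 0 \<Longrightarrow> c3 (x \<star> y) = 0"
  using c3_mult[of x y] v_nonzero by simp

text \<open>The scalar \<open>c3 (e x)\<close> vanishes for all nuclear \<open>x\<close> exactly
  when the nucleus is an ideal.\<close>

lemma mult_v:
  assumes "c3 x = 0"
  shows "x \<star> v = c3 (e \<star> x) \<odot> v" "v \<star> x = c3 (e \<star> x) \<odot> v"
  using c3_mult[of e x] c3_mult[of x e] c3_comm[of x e] assms by simp_all

lemma anticomm_v: "c3 x = 1 \<Longrightarrow> x \<star> v + v \<star> x = c3 (x \<star> x) \<odot> v"
  using c3_mult[of x x] by simp

lemma span_nucleus: "c3 x = 0 \<Longrightarrow> x = c1 x \<odot> v + c2 x \<odot> n"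
  using expand[of x] by simp

text \<open>The normalization \<open>c3 e' = 1\<close> keeps \<open>v\<close> as the associator of
  the new third vector.\<close>

lemma frame_change:
  assumes "c3 e' = 1" "c3 n' = 0" "c2 n' \<noteq> 0"
  shows "frame3 smul mul v n' e'"
proof unfold_locales
  show "indep3 v n' e'"
    by (rule indep3_coordsI) (use assms in auto)
  show "nuclear v" "nuclear n'" "ass e' e' e' = v"
    using assms by (simp_all add: nuclear_def ass_eq)
qed

text \<open>If \<open>l = c3 (e v)\<close> were nonzero, \<open>v / l\<close> would be an idempotent
  acting as identity on \<open>g = v (e v)\<close>, which lies off the nucleus since
  \<open>c3 g = l^2\<close>. Then \<open>c3_mult\<close> for \<open>g g\<close> would place a
  nonzero multiple of \<open>g\<close> on the line of \<open>v\<close>.\<close>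

lemma c3_e_v: "c3 (e \<star> v) = 0"
proof (rule ccontr)
  assume *: "c3 (e \<star> v) \<noteq> 0"
  define l where "l = c3 (e \<star> v)"
  have vv: "v \<star> v = l \<odot> v" using mult_v[of v] by (simp add: l_def)
  define g where "g = v \<star> (e \<star> v)"
  have g: "v \<star> g = l \<odot> g" "g \<star> v = l \<odot> g"
    unfolding g_def using assoc[of v v "e \<star> v"] assoc[of v "e \<star> v" v] assoc[of e v v] by (simp_all add: vv)
  have "c3 g = l * l"
  proof -
    have "e \<star> v = (e \<star> v - l \<odot> e) + l \<odot> e" by simp
    then have "g = v \<star> (e \<star> v - l \<odot> e) + l \<odot> (v \<star> e)" unfolding g_def by (metis mul_simps(2) mul_simps(10))
    moreover have "c3 (v \<star> (e \<star> v - l \<odot> e)) = 0" by (rule c3_mult_zero) (simp_all add: l_def)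
    ultimately show ?thesis using c3_comm[of v e] by (simp add: l_def)
  qed
  moreover have "c3 (g \<star> g) \<odot> v = c3 g \<odot> (l \<odot> g) + c3 g \<odot> (l \<odot> g)"
    using c3_mult[of g g] by (simp add: g)
  from arg_cong[OF this, of c3] have "c3 g * (l * c3 g) = 0" by simp
  ultimately show False using * by (simp add: l_def)
qed

lemma v_v: "v \<star> v = 0"
  using mult_v[of v] c3_e_v by simp

section \<open>Nucleus containing an idempotent\<close>

lemma listed_unital:
  assumes n: "n \<star> n = n" "n \<star> v = v" "v \<star> n = v" "n \<star> e = e" "e \<star> n = e"
    and ee0: "c3 (e \<star> e) = 0"
  shows listed
proof -
  define p q where "p = c2 (e \<star> v)" and "q = c1 (e \<star> v)"
  have ev: "e \<star> v = q \<odot> v + p \<odot> n"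
    using span_nucleus[OF c3_e_v] by (simp add: p_def q_def)
  have ve: "v \<star> e = - (e \<star> v)"
    using anticomm_v[of e] ee0 by (simp add: eq_neg_iff_add_eq_0 add.commute)
  have "p \<odot> v = 0" using assoc[of e v v] by (simp add: v_v ev n)
  then have "p = 0" using v_nonzero by simp
  then have ev: "e \<star> v = q \<odot> v" using ev by simp
  define s t where "s = c2 (e \<star> e)" and "t = c1 (e \<star> e)"
  have ee: "e \<star> e = t \<odot> v + s \<odot> n"
    using span_nucleus[OF ee0] by (simp add: s_def t_def)
  have "s \<odot> v = (q * q) \<odot> v" using assoc[of e e v] by (simp add: ee ev n v_v)
  then have s: "s = q * q" using v_nonzero by simp
  have "(- (t * q)) \<odot> v - (t * q) \<odot> v = v"
    using ass_e by (simp add: ass_def ee n ev ve)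
  \<comment> \<open>Nonassociativity makes both \<open>q\<close> and \<open>t\<close> nonzero, which
    permits the rescaling of the basis below.\<close>
  from arg_cong[OF this, of c1] have tq: "- (t * q) - t * q = 1" by simp
  then have q: "q \<noteq> 0" "t \<noteq> 0" by auto
  have "indep3 ((1 / q) \<odot> e) ((t / (q * q)) \<odot> v) n"
    by (rule indep3_coordsI) (use q in simp)
  then show ?thesis
    by (rule S11) (use q in \<open>simp_all add: n ev ve v_v ee s scale_distribs\<close>)
qed

text \<open>The idempotent splits off, and \<open>e\<close>, \<open>v\<close> span a two-dimensional
  nonassociative algebra. Left and right multiplication by \<open>e\<close> have eigenvalues
  \<open>p\<close> and \<open>\<epsilon> - p\<close> on \<open>v\<close>, one of which is zero;
  scaling \<open>e\<close> turns the other into 2.\<close>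

lemma listed_annihilating:
  assumes n: "n \<star> n = n" "n \<star> v = 0" "v \<star> n = 0" "n \<star> e = 0" "e \<star> n = 0"
  shows listed
proof -
  define \<epsilon> where "\<epsilon> = c3 (e \<star> e)"
  define p where "p = c1 (e \<star> v)"
  have "n \<star> (e \<star> v) = 0" using assoc[of n e v] by (simp add: n)
  moreover have "e \<star> v = p \<odot> v + c2 (e \<star> v) \<odot> n"
    using span_nucleus[OF c3_e_v] by (simp add: p_def)
  ultimately have "c2 (e \<star> v) \<odot> n = 0" by (metis mul_simps(10) mul_simps(2) n(1,2) add_0 scale_zero_right)
  with \<open>e \<star> v = p \<odot> v + c2 (e \<star> v) \<odot> n\<close> have ev: "e \<star> v = p \<odot> v" by simp
  have "v \<star> e = \<epsilon> \<odot> v - e \<star> v"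
    using anticomm_v[of e] by (simp add: \<epsilon>_def algebra_simps)
  then have ve: "v \<star> e = (\<epsilon> - p) \<odot> v" by (simp add: ev scale_distribs)
  define s t where "s = c2 (e \<star> e)" and "t = c1 (e \<star> e)"
  have ee: "e \<star> e = t \<odot> v + s \<odot> n + \<epsilon> \<odot> e"
    using expand[of "e \<star> e"] by (simp add: s_def t_def \<epsilon>_def)
  have "s \<odot> n = 0" using assoc[of n e e] by (simp add: n ee)
  from arg_cong[OF this, of c2] have "s = 0" by simp
  then have ee: "e \<star> e = t \<odot> v + \<epsilon> \<odot> e" using ee by simp
  have "(\<epsilon> * p) \<odot> v = (p * p) \<odot> v" using assoc[of e e v] by (simp add: ee ev v_v)
  then have p: "p = 0 \<or> p = \<epsilon>" using v_nonzero by auto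
  have "t \<odot> (\<epsilon> - p) \<odot> v - t \<odot> p \<odot> v = v"
    using ass_e by (simp add: ass_def ee ev ve scale_distribs)
  from arg_cong[OF this, of c1] have t: "t * (\<epsilon> - p) - t * p = 1" by simp
  then have nz: "t \<noteq> 0" "\<epsilon> \<noteq> 0" using p by auto
  have ind: "indep3 ((2 / \<epsilon>) \<odot> e) ((4 * t / (\<epsilon> * \<epsilon>)) \<odot> v) n"
    by (rule indep3_coordsI) (use nz in simp)
  from p show ?thesis
  proof
    assume "p = 0"
    with nz show ?thesis
      by (intro S06[OF ind]) (simp_all add: n ee ev ve v_v scale_distribs add.commute)
  next
    assume "p = \<epsilon>"
    with nz show ?thesis
      by (intro S09[OF ind]) (simp_all add: n ee ev ve v_v scale_distribs add.commute)
  qed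
qed

text \<open>As \<open>n\<close> acts on \<open>v\<close> by a nonzero scalar, it can be corrected to
  an idempotent \<open>f\<close> fixing \<open>v\<close>. It is a unit of the algebra because the
  third basis vector can be moved into its corner without changing \<open>c3\<close>.\<close>

lemma listed_nonideal_nucleus:
  assumes "c3 (e \<star> n) \<noteq> 0"
  shows listed
proof -
  define l where "l = c3 (e \<star> n)"
  have l: "l \<noteq> 0" using assms by (simp add: l_def)
  have nv: "n \<star> v = l \<odot> v" "v \<star> n = l \<odot> v" using mult_v[of n] by (simp_all add: l_def)
  define a b where "a = c2 (n \<star> n)" and "b = c1 (n \<star> n)"
  have nn: "n \<star> n = b \<odot> v + a \<odot> n"
    using span_nucleus[of "n \<star> n"] c3_mult_zero[of n n] by (simp add: a_def b_def)
  have "(a * l) \<odot> v = (l * l) \<odot> v" using assoc[of n n v] by (simp add: nn nv v_v)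
  then have a: "a = l" using v_nonzero l by simp
  \<comment> \<open>The coefficient of \<open>v\<close> is forced by \<open>f f = f\<close>, given
    \<open>n n = b v + l n\<close>.\<close>
  define f where "f = (1 / l) \<odot> n - (b / (l * l)) \<odot> v"
  have ff: "f \<star> f = f" unfolding vec_eq using l by (simp add: f_def nn nv v_v a field_simps)
  have fv: "f \<star> v = v" "v \<star> f = v" using l by (simp_all add: f_def nv v_v)
  have c3f: "c3 f = 0" "c2 f = 1 / l" by (simp_all add: f_def)
  have cef: "c3 (e \<star> f) = 1" using l by (simp add: f_def c3_e_v l_def)
  define g0 where "g0 = f \<star> (e \<star> f)"
  have fg0: "f \<star> g0 = g0" "g0 \<star> f = g0"
    unfolding g0_def using assoc[of f f "e \<star> f"] assoc[of f "e \<star> f" f] assoc[of e f f] c3f by (simp_all add: ff)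
  have cg0: "c3 g0 = 1"
  proof -
    have "g0 = f \<star> (e \<star> f - e) + f \<star> e" by (simp add: g0_def)
    moreover have "c3 (f \<star> (e \<star> f - e)) = 0" by (rule c3_mult_zero) (simp_all add: c3f cef)
    ultimately show ?thesis using c3_comm[of f e] cef by simp
  qed
  \<comment> \<open>Since \<open>f\<close> is a unit for \<open>g0\<close>, subtracting
    \<open>h f\<close> lowers \<open>c3\<close> of the square by \<open>2 h\<close>.\<close>
  define h where "h = c3 (g0 \<star> g0) / 2"
  define g where "g = g0 - h \<odot> f"
  have fg: "f \<star> g = g" "g \<star> f = g" by (simp_all add: g_def fg0 ff)
  have cg: "c3 g = 1" by (simp add: g_def cg0 c3f)
  have cgg: "c3 (g \<star> g) = 0" by (simp add: g_def fg0 ff cg0 c3f h_def)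
  interpret G: frame3 smul mul v f g
    using cg c3f l by (intro frame_change) simp_all
  have "G.c3 x = c3 x" for x
  proof -
    have "c3 x = c3 (G.c1 x \<odot> v + G.c2 x \<odot> f + G.c3 x \<odot> g)" by (simp only: G.expand[symmetric])
    then show ?thesis by (simp add: cg c3f)
  qed
  with cgg show ?thesis by (intro G.listed_unital) (simp_all add: ff fv fg)
qed

lemma listed_idempotent_nucleus:
  assumes en: "c3 (e \<star> n) = 0" and nn: "c2 (n \<star> n) \<noteq> 0"
  shows listed
proof -
  have nv: "n \<star> v = 0" "v \<star> n = 0" using mult_v[of n] en by simp_all
  define a b where "a = c2 (n \<star> n)" and "b = c1 (n \<star> n)"
  have a: "a \<noteq> 0" using nn by (simp add: a_def)
  have nn: "n \<star> n = b \<odot> v + a \<odot> n"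
    using span_nucleus[of "n \<star> n"] c3_mult_zero[of n n] by (simp add: a_def b_def)
  define f where "f = (1 / a) \<odot> n + (b / (a * a)) \<odot> v"
  have ff: "f \<star> f = f" unfolding vec_eq using a by (simp add: f_def nn nv v_v)
  have fv: "f \<star> v = 0" "v \<star> f = 0" by (simp_all add: f_def nv v_v)
  have c3f: "c3 f = 0" "c2 f = 1 / a" by (simp_all add: f_def)
  have cef: "c3 (e \<star> f) = 0" "c3 (f \<star> e) = 0" using c3_comm[of f e] by (simp_all add: f_def c3_e_v en)
  \<comment> \<open>The Peirce component \<open>(1 - f) e (1 - f)\<close>; the subtracted terms lie
    in the nucleus, so \<open>c3\<close> does not change.\<close>
  define g where "g = e - f \<star> e - e \<star> f + f \<star> (e \<star> f)"
  have cg: "c3 g = 1" using c3_mult_zero[OF c3f(1) cef(1)] by (simp add: g_def cef)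
  have fg: "f \<star> g = 0" "g \<star> f = 0"
    unfolding g_def
    using assoc[of f f "e \<star> f"] assoc[of f "e \<star> f" f] assoc[of e f f] assoc[of f f e] assoc[of f e f] c3f
    by (simp_all add: ff)
  interpret G: frame3 smul mul v f g
    using cg c3f a by (intro frame_change) simp_all
  show ?thesis by (intro G.listed_annihilating) (simp_all add: ff fv fg)
qed

text \<open>A nonzero square \<open>n n = b v\<close> would determine the action of \<open>e\<close>
  on \<open>v\<close> from its action on \<open>n\<close>. Comparing \<open>(e e) n\<close> with
  \<open>e (e n)\<close> then makes the eigenvalues zero, and \<open>ass e e e\<close> would
  vanish.\<close>

lemma nucleus_square_zero:
  assumes en: "c3 (e \<star> n) = 0" and nn: "c2 (n \<star> n) = 0"
  shows "n \<star> n = 0"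
proof (rule ccontr)
  assume nz: "n \<star> n \<noteq> 0"
  have nv: "n \<star> v = 0" "v \<star> n = 0" using mult_v[of n] en by simp_all
  define b where "b = c1 (n \<star> n)"
  have nn: "n \<star> n = b \<odot> v"
    using span_nucleus[of "n \<star> n"] c3_mult_zero[of n n] nn by (simp add: b_def)
  have b: "b \<noteq> 0" using nz nn by auto
  define x y x' y' where "x = c2 (e \<star> n)" and "y = c1 (e \<star> n)" and "x' = c2 (n \<star> e)" and "y' = c1 (n \<star> e)"
  have en': "e \<star> n = y \<odot> v + x \<odot> n" "n \<star> e = y' \<odot> v + x' \<odot> n"
    using span_nucleus[of "e \<star> n"] span_nucleus[of "n \<star> e"] en c3_comm[of n e]
    by (simp_all add: x_def y_def x'_def y'_def)
  have "b \<odot> (e \<star> v) = b \<odot> x \<odot> v" using assoc[of e n n] by (simp add: nn en' nv mult.commute)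
  then have ev: "e \<star> v = x \<odot> v" using b by (metis scale_left_imp_eq)
  have "b \<odot> (v \<star> e) = b \<odot> x' \<odot> v" using assoc[of n n e] by (simp add: nn en' nv mult.commute)
  then have ve: "v \<star> e = x' \<odot> v" using b by (metis scale_left_imp_eq)
  have "(x' * b) \<odot> v = (x * b) \<odot> v" using assoc[of n e n] by (simp add: nn en' nv)
  then have x': "x' = x" using b v_nonzero by simp
  define \<epsilon> s t where "\<epsilon> = c3 (e \<star> e)" and "s = c2 (e \<star> e)" and "t = c1 (e \<star> e)"
  have ee: "e \<star> e = t \<odot> v + s \<odot> n + \<epsilon> \<odot> e"
    using expand[of "e \<star> e"] by (simp add: s_def t_def \<epsilon>_def)
  have \<epsilon>: "\<epsilon> = x + x"
    using arg_cong[OF anticomm_v[of e], of c1] by (simp add: ev ve x' \<epsilon>_def)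
  have *: "(e \<star> e) \<star> n = e \<star> (e \<star> n)" by (rule assoc) simp
  have "x = 0" using arg_cong[OF *, of c2] by (simp add: ee en' ev nv nn \<epsilon>)
  then have "s * b = 0" using arg_cong[OF *, of c1] by (simp add: ee en' ev nv nn \<epsilon>)
  then have "ass e e e = 0" using b \<open>x = 0\<close> x' \<epsilon> by (simp add: ass_def ee ev ve)
  then show False using ass_e v_nonzero by simp
qed

lemma indep3_rotate: "indep3 y z x \<Longrightarrow> indep3 x y z"
  unfolding indep3_def by (metis add.assoc add.commute)

section \<open>Nucleus with zero product\<close>

context
  assumes en0: "c3 (e \<star> n) = 0" and nn0: "n \<star> n = 0"
begin

lemma nucleus_mult_zero:
  assumes "c3 x = 0" "c3 y = 0"
  shows "x \<star> y = 0"
proof -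
  have "n \<star> v = 0" "v \<star> n = 0" using mult_v[of n] en0 by simp_all
  then have "(c1 x \<odot> v + c2 x \<odot> n) \<star> (c1 y \<odot> v + c2 y \<odot> n) = 0"
    by (simp add: v_v nn0)
  then show ?thesis using span_nucleus assms by metis
qed

lemma nucleus_ideal:
  assumes "c3 x = 0"
  shows "c3 (y \<star> x) = 0" "c3 (x \<star> y) = 0"
proof -
  have "c3 (e \<star> (c1 x \<odot> v + c2 x \<odot> n)) = 0" by (simp add: c3_e_v en0)
  then have ex: "c3 (e \<star> x) = 0" using span_nucleus assms by metis
  have "y \<star> x = (y - c3 y \<odot> e) \<star> x + c3 y \<odot> (e \<star> x)" by simp
  moreover have "(y - c3 y \<odot> e) \<star> x = 0" using assms by (intro nucleus_mult_zero) simp_all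
  ultimately show "c3 (y \<star> x) = 0" using ex by simp
  then show "c3 (x \<star> y) = 0" using c3_comm[of x y] by simp
qed

text \<open>On the nucleus, left and right multiplication by \<open>e\<close> commute and square to
  zero, because \<open>e e\<close> is nuclear. With \<open>u = e e\<close> and
  \<open>v = u e - e u\<close> as a basis of the nucleus, this forces \<open>e\<close> to annihilate
  \<open>v\<close>.\<close>

lemma listed_nilpotent:
  assumes ee: "c3 (e \<star> e) = 0"
  shows listed
proof -
  define u where "u = e \<star> e"
  have cu: "c3 u = 0" by (simp add: u_def ee)
  have ll: "e \<star> (e \<star> x) = 0" and rr: "(x \<star> e) \<star> e = 0" and lr: "(e \<star> x) \<star> e = e \<star> (x \<star> e)"
    if "c3 x = 0" for x
    using assoc[of e e x] assoc[of x e e] assoc[of e x e] that nucleus_mult_zero[OF cu that]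
      nucleus_mult_zero[OF that cu] by (simp_all add: u_def)
  have v: "v = u \<star> e - e \<star> u" using ass_e by (simp add: ass_def u_def)
  have ve: "v \<star> e = - (e \<star> v)"
    using anticomm_v[of e] ee by (simp add: eq_neg_iff_add_eq_0 add.commute)
  \<comment> \<open>If \<open>u = t v\<close>, then \<open>v\<close> would be a multiple of
    \<open>v e\<close>, hence \<open>v e\<close> a multiple of \<open>(v e) e = 0\<close>.\<close>
  have u_ind: "u \<noteq> t \<odot> v" for t
  proof
    assume u: "u = t \<odot> v"
    then have "t \<noteq> 0" using v v_nonzero by auto
    have "v = t \<odot> (v \<star> e + v \<star> e)" using v unfolding u by (simp add: ve scale_distribs)
    then have "v = (t * 2) \<odot> (v \<star> e)" using scale_left_distrib[of t t "v \<star> e"]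
      by (simp add: scale_right_distrib mult.commute)
    then have "v \<star> e = (t * 2) \<odot> ((v \<star> e) \<star> e)" by (metis mul_simps(9))
    then have "v \<star> e = 0" using rr[of v] by simp
    with \<open>v = (t * 2) \<odot> (v \<star> e)\<close> v_nonzero show False by simp
  qed
  have c2u: "c2 u \<noteq> 0" using u_ind span_nucleus[OF cu] by force
  interpret U: frame3 smul mul v u e
    using cu c2u by (intro frame_change) simp_all
  have c3: "U.c3 x = c3 x" for x
  proof -
    have "c3 x = c3 (U.c1 x \<odot> v + U.c2 x \<odot> u + U.c3 x \<odot> e)" by (simp only: U.expand[symmetric])
    then show ?thesis by (simp add: cu)
  qed
  define \<alpha> \<beta> where "\<alpha> = U.c1 (e \<star> v)" and "\<beta> = U.c2 (e \<star> v)"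
  have ev: "e \<star> v = \<alpha> \<odot> v + \<beta> \<odot> u"
    using U.span_nucleus[of "e \<star> v"] c3_e_v by (simp add: c3 \<alpha>_def \<beta>_def)
  have 1: "\<alpha> \<odot> (e \<star> v) + \<beta> \<odot> (e \<star> u) = 0" using ll[of v] by (simp add: ev)
  have "(e \<star> v) \<star> e = 0" using ll[of v] lr[of v] by (simp add: ve)
  then have "\<alpha> \<odot> (v \<star> e) + \<beta> \<odot> (u \<star> e) = 0" by (simp add: ev)
  then have 2: "\<beta> \<odot> (u \<star> e) - \<alpha> \<odot> (e \<star> v) = 0" by (simp add: ve)
  have "\<beta> \<odot> (e \<star> u) = - (\<alpha> \<odot> (e \<star> v))"
    using 1 by (simp only: eq_neg_iff_add_eq_0 add.commute)
  moreover have "\<beta> \<odot> (u \<star> e) = \<alpha> \<odot> (e \<star> v)" using 2 by simp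
  moreover have "\<beta> \<odot> v = \<beta> \<odot> (u \<star> e) - \<beta> \<odot> (e \<star> u)"
    using arg_cong[OF v, of "smul \<beta>"] by (simp add: scale_right_diff_distrib)
  \<comment> \<open>Comparing coordinates here gives \<open>\<alpha> * \<beta> = 0\<close> and
    \<open>\<beta> = 2 * \<alpha>^2\<close>, so both vanish.\<close>
  ultimately have "\<beta> \<odot> v = \<alpha> \<odot> (e \<star> v) + \<alpha> \<odot> (e \<star> v)" by simp
  then have eq: "\<beta> \<odot> v = (\<alpha> * \<alpha>) \<odot> v + (\<alpha> * \<alpha>) \<odot> v + (\<alpha> * \<beta>) \<odot> u + (\<alpha> * \<beta>) \<odot> u"
    by (simp add: ev scale_distribs add_ac)
  have "\<alpha> * \<beta> = 0" using arg_cong[OF eq, of U.c2] by simp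
  moreover have "\<beta> = \<alpha> * \<alpha> + \<alpha> * \<alpha>" using arg_cong[OF eq, of U.c1] by simp
  ultimately have "\<alpha> = 0 \<and> \<beta> = 0" by auto
  then have ev: "e \<star> v = 0" "v \<star> e = 0" using ev ve by simp_all
  define a b where "a = U.c1 (e \<star> u)" and "b = U.c2 (e \<star> u)"
  have eu: "e \<star> u = a \<odot> v + b \<odot> u"
    using U.span_nucleus[of "e \<star> u"] nucleus_ideal[OF cu] by (simp add: c3 a_def b_def)
  have "b \<odot> (e \<star> u) = 0" using ll[OF cu] by (simp add: eu ev)
  then have "b \<odot> (a \<odot> v + b \<odot> u) = 0" by (simp only: eu)
  from arg_cong[OF this, of U.c2] have "b = 0" by simp
  then have eu: "e \<star> u = a \<odot> v" using eu by simp
  have ue: "u \<star> e = a \<odot> v + v" using v eu by (simp add: algebra_simps)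
  \<comment> \<open>Solves \<open>(k + 1) z = a v\<close> and \<open>(k - 1) z = (a + 1) v\<close>;
    the difference of the two equations fixes \<open>z\<close>.\<close>
  define k z where "k = - 2 * a - 1" and "z = (- 1 / 2) \<odot> v"
  have eu: "e \<star> u = (k + 1) \<odot> z" by (simp add: eu k_def z_def)
  have ue: "u \<star> e = (k - 1) \<odot> z"
    unfolding U.vec_eq by (simp add: ue k_def z_def field_simps)
  have z: "c3 z = 0" "e \<star> z = 0" "z \<star> e = 0" by (simp_all add: z_def ev)
  have "indep3 e u z" by (rule U.indep3_coordsI) (simp add: z_def)
  then show ?thesis
    by (rule S01[where \<alpha> = k]) (simp_all add: eu ue z u_def[symmetric] nucleus_mult_zero cu)
qed

text \<open>Left and right multiplication by \<open>e\<close>, divided by \<open>\<epsilon>\<close>,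
  are commuting projections of the nucleus, which therefore has a basis of joint eigenvectors. After
  normalization \<open>E E = 2 E + U\<close>, and which eigencomponents occur in \<open>U\<close>
  and in a complement decides the table.\<close>

lemma listed_square_zero_nucleus:
  assumes "c3 (e \<star> e) \<noteq> 0"
  shows listed
proof -
  define \<epsilon> where "\<epsilon> = c3 (e \<star> e)"
  have \<epsilon>: "\<epsilon> \<noteq> 0" using assms by (simp add: \<epsilon>_def)
  define u where "u = e \<star> e - \<epsilon> \<odot> e"
  have cu: "c3 u = 0" by (simp add: u_def \<epsilon>_def)
  have ee: "e \<star> e = \<epsilon> \<odot> e + u" by (simp add: u_def)
  have ll: "e \<star> (e \<star> x) = \<epsilon> \<odot> (e \<star> x)" and rr: "(x \<star> e) \<star> e = \<epsilon> \<odot> (x \<star> e)"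
    and lr: "(e \<star> x) \<star> e = e \<star> (x \<star> e)"
    if "c3 x = 0" for x
    using assoc[of e e x] assoc[of x e e] assoc[of e x e] that nucleus_mult_zero[OF cu that]
      nucleus_mult_zero[OF that cu] by (simp_all add: ee)
  \<comment> \<open>The shift by \<open>w\<close> removes from \<open>u\<close> the components on which left and right multiplication by \<open>e\<close> agree.\<close>
  define w where "w = (1 / \<epsilon>) \<odot> u - (1 / (\<epsilon> * \<epsilon>)) \<odot> (e \<star> u + u \<star> e)"
  define E where "E = (2 / \<epsilon>) \<odot> (e + w)"
  define U where "U = E \<star> E - 2 \<odot> E"
  have cw: "c3 w = 0" using nucleus_ideal[OF cu] cu by (simp add: w_def)
  have cE: "c3 E = 2 / \<epsilon>" by (simp add: E_def cw)
  have Ex: "E \<star> x = (2 / \<epsilon>) \<odot> (e \<star> x)" "x \<star> E = (2 / \<epsilon>) \<odot> (x \<star> e)" if "c3 x = 0" for x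
    using nucleus_mult_zero[OF cw that] nucleus_mult_zero[OF that cw] by (simp_all add: E_def)
  have EL: "E \<star> (E \<star> x) = 2 \<odot> (E \<star> x)" and ER: "(x \<star> E) \<star> E = 2 \<odot> (x \<star> E)"
    and ELR: "(E \<star> x) \<star> E = E \<star> (x \<star> E)" if "c3 x = 0" for x
    using \<epsilon> ll[OF that] rr[OF that] lr[OF that]
    by (simp_all add: Ex nucleus_ideal that)
  \<comment> \<open>The vectors reached from \<open>u\<close> by the two multiplications;
    \<open>Q\<close> arises in both orders because they commute.\<close>
  define X Y Q where "X = e \<star> u" and "Y = u \<star> e" and "Q = e \<star> Y"
  have XYQ: "e \<star> X = \<epsilon> \<odot> X" "e \<star> Y = Q" "X \<star> e = Q" "Y \<star> e = \<epsilon> \<odot> Y" "e \<star> Q = \<epsilon> \<odot> Q" "Q \<star> e = \<epsilon> \<odot> Q"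
    using ll[OF cu] rr[OF cu] lr[OF cu] ll[of Y] lr[of Y] nucleus_ideal[OF cu]
    by (simp_all add: X_def Y_def Q_def)
  have w: "w = (1 / \<epsilon>) \<odot> u - (1 / (\<epsilon> * \<epsilon>)) \<odot> (X + Y)" by (simp add: w_def X_def Y_def)
  have ew: "e \<star> w = (- 1 / (\<epsilon> * \<epsilon>)) \<odot> Q" "w \<star> e = (- 1 / (\<epsilon> * \<epsilon>)) \<odot> Q"
    unfolding w vec_eq using \<epsilon> by (simp_all add: XYQ X_def[symmetric] Y_def[symmetric] field_simps)
  have cXYQ: "c3 X = 0" "c3 Y = 0" "c3 Q = 0"
    using nucleus_ideal cu by (simp_all add: X_def Y_def Q_def)
  have U_eq: "U = (4 / (\<epsilon> * \<epsilon> * \<epsilon>)) \<odot> (X + Y) - (8 / (\<epsilon> * \<epsilon> * \<epsilon> * \<epsilon>)) \<odot> Q"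
    unfolding U_def E_def vec_eq using \<epsilon>
    by (simp add: ew ee nucleus_mult_zero cw) (simp add: w cu cXYQ field_simps)
  have cU: "c3 U = 0" by (simp add: U_eq cXYQ)
  have EU: "E \<star> U + U \<star> E = 2 \<odot> U"
    unfolding Ex[OF cU] unfolding U_eq vec_eq using \<epsilon> by (simp add: XYQ field_simps)
  have EE: "E \<star> E = 2 \<odot> E + U" by (simp add: U_def)
  have "ass E E E = U \<star> E - E \<star> U" by (simp add: ass_def EE)
  \<comment> \<open>By \<open>ass_eq\<close> the associator of \<open>E\<close> is
    \<open>(2 / \<epsilon>)^3\<close> times \<open>v\<close>.\<close>
  then have "U \<noteq> 0" using ass_eq[of E E E] cE \<epsilon> v_nonzero by auto
  \<comment> \<open>The components of \<open>U\<close> with left and right eigenvalues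
    \<open>(2, 0)\<close> and \<open>(0, 2)\<close>.\<close>
  define a b where "a = (1 / 2) \<odot> (E \<star> U)" and "b = (1 / 2) \<odot> (U \<star> E)"
  have ab: "c3 a = 0" "c3 b = 0" using nucleus_ideal[OF cU] by (simp_all add: a_def b_def)
  have "a + b = (1 / 2) \<odot> (E \<star> U + U \<star> E)" by (simp add: a_def b_def scale_distribs)
  then have Uab: "U = a + b" by (simp add: EU)
  have "E \<star> (E \<star> U + U \<star> E) = E \<star> (2 \<odot> U)" "(E \<star> U + U \<star> E) \<star> E = (2 \<odot> U) \<star> E" unfolding EU by simp_all
  then have LR: "E \<star> (U \<star> E) = 0" "(E \<star> U) \<star> E = 0"
    by (simp_all add: EL[OF cU] ER[OF cU])
  have Ea: "E \<star> a = 2 \<odot> a" "a \<star> E = 0" and Eb: "E \<star> b = 0" "b \<star> E = 2 \<odot> b"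
    by (simp_all add: a_def b_def EL[OF cU] ER[OF cU] LR)
  have zero: "x \<star> y = 0" if "c3 x = 0" "c3 y = 0" for x y using nucleus_mult_zero that .
  \<comment> \<open>Completes a nuclear vector by a joint eigenvector: a nuclear vector off the line
    of \<open>x\<close> is split by the projection \<open>E y / 2\<close> and then by
    \<open>y E / 2\<close>, and each time one part stays off the line.\<close>
  have second: "\<exists>y i j. c3 y = 0 \<and> indep3 E x y \<and> E \<star> y = i \<odot> y \<and> y \<star> E = j \<odot> y \<and> i \<in> {0, 2} \<and> j \<in> {0, 2}"
    if x: "c3 x = 0" "x \<noteq> 0" for x
  proof -
    have line: "p + q \<in> span {x}" if "p \<in> span {x}" "q \<in> span {x}" for p q
      using that by (rule span_add)
    have "v \<notin> span {x} \<or> n \<notin> span {x}"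
    proof (rule ccontr)
      assume "\<not> (v \<notin> span {x} \<or> n \<notin> span {x})"
      then obtain k k' where k: "v = k \<odot> x" "n = k' \<odot> x" by (auto simp: span_singleton)
      have "k' \<odot> v + (- k) \<odot> n + 0 \<odot> e = 0" unfolding k by (simp add: mult.commute)
      from indep3D[OF indep this] k v_nonzero show False by simp
    qed
    then obtain y0 where y0: "y0 \<notin> span {x}" "c3 y0 = 0" by auto
    have half: "y = (1 / 2) \<odot> y' + (y - (1 / 2) \<odot> y')" for y y' by simp
    obtain y1 i where y1: "y1 \<notin> span {x}" "c3 y1 = 0" "E \<star> y1 = i \<odot> y1" "i \<in> {0, 2}"
    proof (cases "(1 / 2) \<odot> (E \<star> y0) \<in> span {x}")
      case True
      then have "y0 - (1 / 2) \<odot> (E \<star> y0) \<notin> span {x}" using line half y0(1) by metis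
      then show thesis using y0(2) nucleus_ideal by (intro that[of "y0 - (1 / 2) \<odot> (E \<star> y0)" 0]) (simp_all add: EL)
    next
      case False
      then show thesis using y0(2) nucleus_ideal by (intro that[of "(1 / 2) \<odot> (E \<star> y0)" 2]) (simp_all add: EL)
    qed
    have ELR1: "E \<star> (y1 \<star> E) = i \<odot> (y1 \<star> E)" using ELR[OF y1(2)] y1(3) by simp
    obtain y j where y: "y \<notin> span {x}" "c3 y = 0" "E \<star> y = i \<odot> y" "y \<star> E = j \<odot> y" "j \<in> {0, 2}"
    proof (cases "(1 / 2) \<odot> (y1 \<star> E) \<in> span {x}")
      case True
      then have "y1 - (1 / 2) \<odot> (y1 \<star> E) \<notin> span {x}" using line half y1(1) by metis
      then show thesis using y1(2) nucleus_ideal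
        by (intro that[of "y1 - (1 / 2) \<odot> (y1 \<star> E)" 0]) (simp_all add: ER y1(3) ELR1 scale_distribs mult.commute)
    next
      case False
      then show thesis using y1(2) nucleus_ideal
        by (intro that[of "(1 / 2) \<odot> (y1 \<star> E)" 2]) (simp_all add: ER ELR1 mult.commute)
    qed
    have "indep3 x y E"
      using x y(1,2) cE \<epsilon> by (intro indep3I) (auto simp: span_singleton)
    then have "indep3 E x y" by (rule indep3_rotate)
    then show ?thesis using y y1(4) by blast
  qed
  consider "a \<noteq> 0" "b \<noteq> 0" | "a \<noteq> 0" "b = 0" | "a = 0" "b \<noteq> 0" using \<open>U \<noteq> 0\<close> Uab
    by (cases "a = 0"; cases "b = 0") simp_all
  then show ?thesis
  proof cases
    case 1
    have "b \<noteq> t \<odot> a" for t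
    proof
      assume b: "b = t \<odot> a"
      then have "E \<star> b = 2 \<odot> b" by (simp add: Ea mult.commute)
      with Eb 1 show False by simp
    qed
    then have "indep3 a b E" using 1 ab cE \<epsilon> by (intro indep3I) auto
    then have "indep3 E a b" by (rule indep3_rotate)
    then show ?thesis by (rule S03) (simp_all add: EE Uab Ea Eb zero ab add.assoc)
  next
    case 2
    obtain y i j where y: "c3 y = 0" "indep3 E a y" "E \<star> y = i \<odot> y" "y \<star> E = j \<odot> y"
      and ij: "i \<in> {0, 2}" "j \<in> {0, 2}"
      using second[OF ab(1) 2(1)] by blast
    have EE: "E \<star> E = 2 \<odot> E + a" using EE Uab 2 by simp
    consider "i = 0" "j = 0" | "i = 2" "j = 2" | "i = 2" "j = 0" | "i = 0" "j = 2" using ij by auto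
    then show ?thesis
    proof cases
      case 1
      then show ?thesis by (intro S10[OF y(2)]) (simp_all add: EE Ea zero ab y)
    next
      case 2
      then show ?thesis by (intro S08[OF y(2)]) (simp_all add: EE Ea zero ab y)
    next
      case 3
      then show ?thesis by (intro S12[OF y(2)]) (simp_all add: EE Ea zero ab y)
    next
      case 4
      then show ?thesis by (intro S02[OF y(2)]) (simp_all add: EE Ea zero ab y)
    qed
  next
    case 3
    obtain y i j where y: "c3 y = 0" "indep3 E b y" "E \<star> y = i \<odot> y" "y \<star> E = j \<odot> y"
      and ij: "i \<in> {0, 2}" "j \<in> {0, 2}"
      using second[OF ab(2) 3(2)] by blast
    have EE: "E \<star> E = 2 \<odot> E + b" using EE Uab 3 by simp
    consider "i = 0" "j = 0" | "i = 2" "j = 2" | "i = 2" "j = 0" | "i = 0" "j = 2" using ij by auto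
    then show ?thesis
    proof cases
      case 1
      then show ?thesis by (intro S07[OF y(2)]) (simp_all add: EE Eb zero ab y)
    next
      case 2
      then show ?thesis by (intro S05[OF y(2)]) (simp_all add: EE Eb zero ab y)
    next
      case 3
      have ind: "indep3 E y b"
        using y(2) unfolding indep3_def by (metis add.assoc add.commute)
      then show ?thesis using 3 by (intro S04[OF ind]) (simp_all add: EE Eb zero ab y)
    next
      case 4
      then show ?thesis by (intro S13[OF y(2)]) (simp_all add: EE Eb zero ab y)
    qed
  qed
qed

end

section \<open>Conclusion of the nonassociative case and of the classification\<close>

lemma listed_frame: listed
proof (cases "c3 (e \<star> n) = 0")
  case True
  show ?thesis
  proof (cases "c2 (n \<star> n) = 0")
    case nn: True
    have "n \<star> n = 0" using nucleus_square_zero[OF True nn] .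
    then show ?thesis using listed_nilpotent[OF True] listed_square_zero_nucleus[OF True] by blast
  next
    case False
    then show ?thesis using listed_idempotent_nucleus True by blast
  qed
next
  case False
  then show ?thesis by (rule listed_nonideal_nucleus)
qed

end

context nonassociative3
begin

lemma listed_nonassociative: listed
proof -
  obtain n where n: "nuclear n" "\<And>c. n \<noteq> c \<odot> v" using nucleus_not_line by blast
  have "e \<noteq> a \<odot> v + b \<odot> n" for a b
    using nuclear_independent nuclear_lin nuclear_v n(1) by metis
  then have "indep3 v n e" using v(2) n(2) by (intro indep3I)
  then interpret frame3 smul mul v n e
    by unfold_locales (simp_all add: nuclear_v n(1) v(1)[symmetric])
  show ?thesis by (rule listed_frame)
qed

end

text \<open>Two transpositions give the cyclic identity, and isomorphisms carry it over; so no table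
  has to be checked for semi-alternativity separately.\<close>

lemma semi_alternative_isomorphic:
  assumes "algebra_isomorphic s m s' m'" "assosymmetric m"
  shows "semi_alternative m'"
proof -
  obtain f where f: "Vector_Spaces.linear s s' f" "bij f" "\<And>x y. f (m x y) = m' (f x) (f y)"
    using assms(1) unfolding algebra_isomorphic_def by blast
  interpret Vector_Spaces.linear s s' f by (rule f)
  have ass: "f (associator m x y z) = associator m' (f x) (f y) (f z)" for x y z
    by (simp add: associator_def diff f(3))
  have perm: "associator m x y z = associator m y z x" for x y z
    using assms(2) unfolding assosymmetric_def by metis
  have "associator m' x y z = associator m' y z x" for x y z
  proof -
    obtain x' y' z' where "x = f x'" "y = f y'" "z = f z'"
      using bij_is_surj[OF f(2)] unfolding surj_def by meson
    then show ?thesis by (simp add: ass[symmetric] perm[of x' y' z'])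
  qed
  then show ?thesis unfolding semi_alternative_def by blast
qed

theorem corollary29:
  fixes smul :: "complex \<Rightarrow> 'a::ab_group_add \<Rightarrow> 'a"
    and mul :: "'a \<Rightarrow> 'a \<Rightarrow> 'a"
  assumes "complex_algebra smul mul"
    and "vector_space.dim smul (UNIV :: 'a set) = 3"
    and "assosymmetric mul"
    and nontrivial: "\<exists>x y. mul x y \<noteq> 0"
  shows "\<exists>t \<in> listed_tables.
    semi_alternative (mult_of t) \<and> algebra_isomorphic smul mul vector_scalar_mult (mult_of t)"
proof -
  interpret assosym3 smul mul
    using assms(1-3) by (simp add: assosym3_def assosym3_axioms_def algebra3_def algebra3_axioms_def)
  have listed
  proof (cases "\<exists>e. ass e e e \<noteq> 0")
    case True
    then obtain e where "ass e e e \<noteq> 0" by blast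
    then interpret nonassociative3 smul mul e "ass e e e"
      by unfold_locales simp_all
    show ?thesis by (rule listed_nonassociative)
  next
    case False
    then have "ass x y z = 0" for x y z using ass_zeroI by blast
    then interpret assoc3 smul mul
      by unfold_locales (simp add: ass_def)
    show ?thesis using nontrivial listed_associative by blast
  qed
  then show ?thesis
    unfolding listed_def using semi_alternative_isomorphic assms(3) by blast
qed

end
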